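(* Let $m,l\in\mathbb{R}$, let $M^3_{m,l}$ be the Bianchi-Cartan-Vranceanu 3-space with metric $g=\frac{dx^2+dy^2}{[1+m(x^2+y^2)]^2}+\left[dz+\frac{l}{2}\frac{y\,dx-x\,dy}{1+m(x^2+y^2)}\right]^2$, and let $\pi:M^3_{m,l}\to\left(\mathbb{R}^{2},h=\frac{dx^2+dy^2}{[1+m(x^2+y^2)]^2}\right)$, $\pi(x,y,z)=(x,y)$, be the Riemannian submersion. Let $\alpha:I\to(\mathbb{R}^2,h)$ be an immersed regular curve parametrized by arclength, $I$ an interval. Then the Hopf cylinder $\Sigma=\bigcup_{s\in I}\pi^{-1}(\alpha(s))$ is a proper biharmonic surface in $M^3_{m,l}$ if and only if it is a part of: (1) $S^1(1/(2\sqrt{2m}))\times\mathbb{R}$ in $S^2(1/(2\sqrt{m}))\times\mathbb{R}$ (here $m>0$ and $l=0$); or (2) a Hopf cylinder in $SU(2)$ with $4m-l^2>0$ (here $m>0$, $l\ne0$) over a circle of radius $R=1/\sqrt{8m-l^2}$ in the base sphere $S^2\left(\frac{1}{2\sqrt{m}}\right)$ identified with $\left(\mathbb{R}^{2},h=\frac{dx^2+dy^2}{[1+m(x^2+y^2)]^2}\right)$.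
   Context: All manifolds and maps are smooth. A map $\varphi:(M,g)\to(N,h)$ of Riemannian manifolds is biharmonic if for every compact $\Omega\subset M$ it is a critical point of the bienergy $E^2(\varphi,\Omega)=\frac12\int_\Omega|\tau(\varphi)|^2dx$, where $\tau(\varphi)=\mathrm{Trace}_g\nabla d\varphi$ is the tension field; equivalently $\mathrm{Trace}_{g}(\nabla^{\varphi}\nabla^{\varphi}-\nabla^{\varphi}_{\nabla^{M}})\tau(\varphi)-\mathrm{Trace}_{g}R^{N}(d\varphi,\tau(\varphi))d\varphi=0$, with $R^N(X,Y)Z=[\nabla^N_X,\nabla^N_Y]Z-\nabla^N_{[X,Y]}Z$. A surface (immersed 2-dimensional submanifold with induced metric) is biharmonic if its isometric immersion is a biharmonic map, and proper biharmonic if it is biharmonic but not minimal. The underlying manifold of $M^3_{m,l}$ is $\{(x,y,z)\in\mathbb{R}^3:1+m(x^2+y^2)>0\}$, and the base of $\pi$ is the corresponding domain of $\mathbb{R}^2$; $h$ has constant curvature $4m$. $S^n(r)$ is the round sphere of radius $r$ in $\mathbb{R}^{n+1}$. For $m>0$, $(\mathbb{R}^2,h)$ is identified (by stereographic projection) with $S^2(1/(2\sqrt m))$ minus a point; a circle of radius $R$ in this sphere means a curve that is a Euclidean circle of radius $R$ in $\mathbb{R}^3$, and $S^1(1/(2\sqrt{2m}))\subset S^2(1/(2\sqrt m))$ is such a circle of radius $1/(2\sqrt{2m})$. $M^3_{m,0}$ with $m>0$ is (locally) $S^2(1/(2\sqrt m))\times\mathbb{R}$; $M^3_{m,l}$ with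 $m>0$, $l\ne0$ is referred to as $SU(2)$ (to which it is locally isometric, with a left-invariant metric). "A part of" means an open piece, with the ambient space identified through these local isometries. *)

theory Defs
  imports "HOL-Analysis.Analysis"
begin

section \<open>Riemannian geometry in a global chart\<close>

text \<open>
  All Riemannian manifolds below are open subsets of \<open>real ^ 'n\<close> carrying a metric
  \<open>g p u v\<close> (base point \<open>p\<close>, tangent vectors \<open>u\<close>, \<open>v\<close>). Vector fields, and vector fields
  along a map, are functions of the base point. The formulas are total functions of the point;
  they have their geometric meaning on the open set where the data are smooth.
\<close>

type_synonym 'n metric = "real ^ 'n \<Rightarrow> real ^ 'n \<Rightarrow> real ^ 'n \<Rightarrow> real"

definition dmap :: "(real ^ 'm \<Rightarrow> real ^ 'n) \<Rightarrow> real ^ 'm \<Rightarrow> real ^ 'm \<Rightarrow> real ^ 'n" where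
  "dmap f p u = frechet_derivative f (at p) u"

definition gram :: "'n metric \<Rightarrow> real ^ 'n \<Rightarrow> real ^ 'n ^ 'n" where
  "gram g p = (\<chi> i j. g p (axis i 1) (axis j 1))"

definition gram_partial :: "'n metric \<Rightarrow> real ^ 'n \<Rightarrow> 'n \<Rightarrow> 'n \<Rightarrow> 'n \<Rightarrow> real" where
  "gram_partial g p i j k = frechet_derivative (\<lambda>q. gram g q $ j $ k) (at p) (axis i 1)"

definition christoffel :: "'n metric \<Rightarrow> real ^ 'n \<Rightarrow> 'n \<Rightarrow> 'n \<Rightarrow> 'n \<Rightarrow> real" where
  "christoffel g p k i j = (\<Sum>r\<in>UNIV. matrix_inv (gram g p) $ k $ r *
     (gram_partial g p i j r + gram_partial g p j i r - gram_partial g p r i j)) / 2"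

definition christoffel_form :: "'n metric \<Rightarrow> real ^ 'n \<Rightarrow> real ^ 'n \<Rightarrow> real ^ 'n \<Rightarrow> real ^ 'n" where
  "christoffel_form g p u v =
     (\<chi> k. \<Sum>i\<in>UNIV. \<Sum>j\<in>UNIV. christoffel g p k i j * u $ i * v $ j)"

definition levi_civita ::
  "'n metric \<Rightarrow> (real ^ 'n \<Rightarrow> real ^ 'n) \<Rightarrow> (real ^ 'n \<Rightarrow> real ^ 'n) \<Rightarrow> real ^ 'n \<Rightarrow> real ^ 'n" where
  "levi_civita g X Y p = dmap Y p (X p) + christoffel_form g p (X p) (Y p)"

definition lie_bracket ::
  "(real ^ 'n \<Rightarrow> real ^ 'n) \<Rightarrow> (real ^ 'n \<Rightarrow> real ^ 'n) \<Rightarrow> real ^ 'n \<Rightarrow> real ^ 'n" where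
  "lie_bracket X Y p = dmap Y p (X p) - dmap X p (Y p)"

definition curvature :: "'n metric \<Rightarrow> (real ^ 'n \<Rightarrow> real ^ 'n) \<Rightarrow> (real ^ 'n \<Rightarrow> real ^ 'n) \<Rightarrow>
    (real ^ 'n \<Rightarrow> real ^ 'n) \<Rightarrow> real ^ 'n \<Rightarrow> real ^ 'n" where
  "curvature g X Y Z p = levi_civita g X (levi_civita g Y Z) p
     - levi_civita g Y (levi_civita g X Z) p - levi_civita g (lie_bracket X Y) Z p"

text \<open>
  The curvature is tensorial, so its value on tangent vectors at \<open>p\<close> may be computed with
  constant extensions. The same device is used below for the Hessian \<open>\<nabla>d\<phi>\<close> and for the second
  covariant derivative of the tension field.
\<close>

definition curvature_at ::
  "'n metric \<Rightarrow> real ^ 'n \<Rightarrow> real ^ 'n \<Rightarrow> real ^ 'n \<Rightarrow> real ^ 'n \<Rightarrow> real ^ 'n" where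
  "curvature_at g p u v w = curvature g (\<lambda>_. u) (\<lambda>_. v) (\<lambda>_. w) p"

definition metric_trace ::
  "'m metric \<Rightarrow> real ^ 'm \<Rightarrow> (real ^ 'm \<Rightarrow> real ^ 'm \<Rightarrow> real ^ 'n) \<Rightarrow> real ^ 'n" where
  "metric_trace g p b =
     (\<Sum>i\<in>UNIV. \<Sum>j\<in>UNIV. matrix_inv (gram g p) $ i $ j *\<^sub>R b (axis i 1) (axis j 1))"

text \<open>
  \<open>cov_along h \<phi> V p u\<close> is \<open>\<nabla>\<^sup>\<phi>\<^sub>u V\<close> at \<open>p\<close>: the pull-back to the domain of \<open>\<phi>\<close> of the
  Levi-Civita connection of the target metric \<open>h\<close>, applied to a vector field \<open>V\<close> along \<open>\<phi>\<close>.
\<close>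

definition cov_along :: "'n metric \<Rightarrow> (real ^ 'm \<Rightarrow> real ^ 'n) \<Rightarrow> (real ^ 'm \<Rightarrow> real ^ 'n) \<Rightarrow>
    real ^ 'm \<Rightarrow> real ^ 'm \<Rightarrow> real ^ 'n" where
  "cov_along h \<phi> V p u = dmap V p u + christoffel_form h (\<phi> p) (dmap \<phi> p u) (V p)"

definition nabla_dmap :: "'m metric \<Rightarrow> 'n metric \<Rightarrow> (real ^ 'm \<Rightarrow> real ^ 'n) \<Rightarrow>
    real ^ 'm \<Rightarrow> real ^ 'm \<Rightarrow> real ^ 'm \<Rightarrow> real ^ 'n" where
  "nabla_dmap g h \<phi> p u v =
     cov_along h \<phi> (\<lambda>q. dmap \<phi> q v) p u - dmap \<phi> p (levi_civita g (\<lambda>_. u) (\<lambda>_. v) p)"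

definition tension_field ::
  "'m metric \<Rightarrow> 'n metric \<Rightarrow> (real ^ 'm \<Rightarrow> real ^ 'n) \<Rightarrow> real ^ 'm \<Rightarrow> real ^ 'n" where
  "tension_field g h \<phi> p = metric_trace g p (nabla_dmap g h \<phi> p)"

definition bitension_field ::
  "'m metric \<Rightarrow> 'n metric \<Rightarrow> (real ^ 'm \<Rightarrow> real ^ 'n) \<Rightarrow> real ^ 'm \<Rightarrow> real ^ 'n" where
  "bitension_field g h \<phi> p =
     metric_trace g p (\<lambda>u v.
       cov_along h \<phi> (\<lambda>q. cov_along h \<phi> (tension_field g h \<phi>) q v) p u
       - cov_along h \<phi> (tension_field g h \<phi>) p (levi_civita g (\<lambda>_. u) (\<lambda>_. v) p))
     - metric_trace g p (\<lambda>u v.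
       curvature_at h (\<phi> p) (dmap \<phi> p u) (tension_field g h \<phi> p) (dmap \<phi> p v))"

text \<open>
  A smooth map on the open set \<open>U\<close> is biharmonic, that is, critical for the bienergy
  \<open>1/2 \<integral> |\<tau>(\<phi>)|\<^sup>2\<close> under compactly supported variations, when it satisfies the Euler-Lagrange
  equation: the bitension field vanishes.
\<close>

definition biharmonic_on ::
  "(real ^ 'm) set \<Rightarrow> 'm metric \<Rightarrow> 'n metric \<Rightarrow> (real ^ 'm \<Rightarrow> real ^ 'n) \<Rightarrow> bool" where
  "biharmonic_on U g h \<phi> \<longleftrightarrow> (\<forall>p\<in>U. bitension_field g h \<phi> p = 0)"

definition induced_metric :: "'n metric \<Rightarrow> (real ^ 'm \<Rightarrow> real ^ 'n) \<Rightarrow> 'm metric" where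
  "induced_metric h \<phi> p u v = h (\<phi> p) (dmap \<phi> p u) (dmap \<phi> p v)"

text \<open>
  By the Gauss formula, the second fundamental form of an isometric immersion \<open>\<phi>\<close> is
  \<open>\<nabla>d\<phi>\<close>; the mean curvature vector is its normalised trace.
\<close>

definition mean_curvature_vector ::
  "'n metric \<Rightarrow> (real ^ 'm \<Rightarrow> real ^ 'n) \<Rightarrow> real ^ 'm \<Rightarrow> real ^ 'n" where
  "mean_curvature_vector h \<phi> p = (1 / real CARD('m)) *\<^sub>R
     metric_trace (induced_metric h \<phi>) p (nabla_dmap (induced_metric h \<phi>) h \<phi> p)"

definition minimal_immersion ::
  "(real ^ 'm) set \<Rightarrow> 'n metric \<Rightarrow> (real ^ 'm \<Rightarrow> real ^ 'n) \<Rightarrow> bool" where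
  "minimal_immersion U h \<phi> \<longleftrightarrow> (\<forall>p\<in>U. mean_curvature_vector h \<phi> p = 0)"

text \<open>
  \<open>\<phi>\<close> is meant to be a smooth immersion of the open set \<open>U\<close>; with the induced metric on \<open>U\<close> it is
  an isometric immersion.
\<close>

definition proper_biharmonic_surface ::
  "(real ^ 2) set \<Rightarrow> 'n metric \<Rightarrow> (real ^ 2 \<Rightarrow> real ^ 'n) \<Rightarrow> bool" where
  "proper_biharmonic_surface U h \<phi> \<longleftrightarrow>
     biharmonic_on U (induced_metric h \<phi>) h \<phi> \<and> \<not> minimal_immersion U h \<phi>"


section \<open>Bianchi-Cartan-Vranceanu spaces and Hopf cylinders\<close>

definition bcv_space :: "real \<Rightarrow> (real ^ 3) set" where
  "bcv_space m = {p. 1 + m * ((p $ 1)\<^sup>2 + (p $ 2)\<^sup>2) > 0}"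

definition bcv_metric :: "real \<Rightarrow> real \<Rightarrow> 3 metric" where
  "bcv_metric m l p u v = (let x = p $ 1; y = p $ 2; D = 1 + m * (x\<^sup>2 + y\<^sup>2) in
     (u $ 1 * v $ 1 + u $ 2 * v $ 2) / D\<^sup>2
     + (u $ 3 + l / 2 * ((y * u $ 1 - x * u $ 2) / D))
       * (v $ 3 + l / 2 * ((y * v $ 1 - x * v $ 2) / D)))"

definition base_space :: "real \<Rightarrow> (real ^ 2) set" where
  "base_space m = {q. 1 + m * ((q $ 1)\<^sup>2 + (q $ 2)\<^sup>2) > 0}"

definition base_metric :: "real \<Rightarrow> 2 metric" where
  "base_metric m q u v =
     (u $ 1 * v $ 1 + u $ 2 * v $ 2) / (1 + m * ((q $ 1)\<^sup>2 + (q $ 2)\<^sup>2))\<^sup>2"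

definition bcv_proj :: "real ^ 3 \<Rightarrow> real ^ 2" where
  "bcv_proj p = vector [p $ 1, p $ 2]"

definition hopf_cylinder :: "real \<Rightarrow> (real ^ 2) set \<Rightarrow> (real ^ 3) set" where
  "hopf_cylinder m B = (\<Union>q\<in>B. {p \<in> bcv_space m. bcv_proj p = q})"

definition smooth_curve_on :: "real set \<Rightarrow> (real \<Rightarrow> real ^ 'n) \<Rightarrow> bool" where
  "smooth_curve_on I \<alpha> \<longleftrightarrow>
     (\<forall>k. \<forall>s\<in>I. ((\<lambda>\<beta> t. vector_derivative \<beta> (at t)) ^^ k) \<alpha> differentiable at s)"

definition unit_speed_on :: "real set \<Rightarrow> 'n metric \<Rightarrow> (real \<Rightarrow> real ^ 'n) \<Rightarrow> bool" where
  "unit_speed_on I g \<alpha> \<longleftrightarrow>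
     (\<forall>s\<in>I. g (\<alpha> s) (vector_derivative \<alpha> (at s)) (vector_derivative \<alpha> (at s)) = 1)"

text \<open>
  The Hopf cylinder over a curve \<open>\<alpha>\<close> as an immersed surface: \<open>(s, z)\<close> is sent to the point of
  height \<open>z\<close> on the fibre over \<open>\<alpha> s\<close>.
\<close>

definition hopf_domain :: "real set \<Rightarrow> (real ^ 2) set" where
  "hopf_domain I = {p. p $ 1 \<in> I}"

definition hopf_immersion :: "(real \<Rightarrow> real ^ 2) \<Rightarrow> real ^ 2 \<Rightarrow> real ^ 3" where
  "hopf_immersion \<alpha> p = vector [\<alpha> (p $ 1) $ 1, \<alpha> (p $ 1) $ 2, p $ 2]"

lemma hopf_immersion_image:
  assumes "\<alpha> ` I \<subseteq> base_space m"
  shows "hopf_immersion \<alpha> ` hopf_domain I = hopf_cylinder m (\<alpha> ` I)"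
proof (intro equalityI subsetI)
  fix p assume "p \<in> hopf_immersion \<alpha> ` hopf_domain I"
  then show "p \<in> hopf_cylinder m (\<alpha> ` I)"
    using assms
    by (auto simp: hopf_immersion_def hopf_domain_def hopf_cylinder_def bcv_space_def
        base_space_def bcv_proj_def vec_eq_iff forall_2)
next
  fix p assume "p \<in> hopf_cylinder m (\<alpha> ` I)"
  then obtain s where s: "s \<in> I" "bcv_proj p = \<alpha> s"
    by (auto simp: hopf_cylinder_def)
  have "hopf_immersion \<alpha> (vector [s, p $ 3]) = p"
    using s(2)[symmetric] by (simp add: hopf_immersion_def bcv_proj_def vec_eq_iff forall_3)
  moreover have "vector [s, p $ 3] \<in> hopf_domain I"
    using s(1) by (simp add: hopf_domain_def)
  ultimately show "p \<in> hopf_immersion \<alpha> ` hopf_domain I"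
    by (metis image_eqI)
qed

text \<open>
  For \<open>m > 0\<close>, inverse stereographic projection onto the sphere of radius \<open>1 / (2 * sqrt m)\<close>
  about the origin, minus its north pole. It pulls the round metric back to \<open>base_metric m\<close>.
\<close>

definition inv_stereographic :: "real \<Rightarrow> real ^ 2 \<Rightarrow> real ^ 3" where
  "inv_stereographic m q = (let x = q $ 1; y = q $ 2; D = 1 + m * (x\<^sup>2 + y\<^sup>2) in
     vector [x / D, y / D, (m * (x\<^sup>2 + y\<^sup>2) - 1) / (2 * sqrt m * D)])"

text \<open>The resulting isometry of the space with \<open>l = 0\<close> into the product of sphere and line.\<close>

definition product_identification :: "real \<Rightarrow> real ^ 3 \<Rightarrow> (real ^ 3) \<times> real" where
  "product_identification m p = (inv_stereographic m (bcv_proj p), p $ 3)"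

definition circle_in_sphere :: "real \<Rightarrow> real \<Rightarrow> (real ^ 3) set \<Rightarrow> bool" where
  "circle_in_sphere \<rho> R C \<longleftrightarrow> C \<subseteq> sphere 0 \<rho> \<and> R > 0 \<and>
     (\<exists>c n. norm n = 1 \<and> C = {x. n \<bullet> (x - c) = 0 \<and> dist c x = R})"

definition open_piece :: "'a::topological_space set \<Rightarrow> 'a set \<Rightarrow> bool" where
  "open_piece A B \<longleftrightarrow> openin (top_of_set B) A"

end

theory Submission
  imports Defs
begin

text \<open>
  In the orthonormal frame \<open>T\<close> (horizontal lift of the tangent of \<open>\<alpha>\<close>), \<open>N\<close> (lift of its normal) and
  \<open>E\<^sub>3 = \<partial>\<^sub>z\<close>, the Hopf cylinder is flat with tension field \<open>\<kappa> N\<close>, where \<open>\<kappa>\<close> is the geodesic curvature of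
  \<open>\<alpha>\<close>, and the bitension field is
  \<open>(\<kappa>'' - \<kappa>\<^sup>3 + \<kappa> (4 m - l\<^sup>2)) N - 3 \<kappa> \<kappa>' T + l \<kappa>' E\<^sub>3\<close>.
  Hence the cylinder is proper biharmonic iff \<open>\<kappa>\<close> is constant with \<open>\<kappa>\<^sup>2 = 4 m - l\<^sup>2 > 0\<close>. Under
  stereographic projection \<open>\<alpha>\<close> becomes a curve \<open>\<psi>\<close> in the sphere of curvature \<open>4 m\<close> with
  \<open>T' = \<kappa> N - 4 m \<psi>\<close> and \<open>N' = - \<kappa> T\<close>, so \<open>\<kappa>\<close> is constant iff \<open>\<psi>\<close> runs in a circle, whose radius is
  then \<open>1 / sqrt (4 m + \<kappa>\<^sup>2) = 1 / sqrt (8 m - l\<^sup>2)\<close>.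
\<close>

section \<open>The Koszul formula in coordinates\<close>

text \<open>The obstacle is that the definitions build a connection from Frechet derivatives of Gram
  entries and an inverse matrix, which is too unwieldy to expand in dimension three. Connections are
  therefore not computed but verified: a closed form is proposed and paired with every vector. This
  handles the ambient and the induced metric alike. No sign of m is assumed for the bitension field.
  The normal equation itself yields 4 m > l^2, hence m > 0, and only then does stereographic
  projection enter. The two cases of the theorem rest on the same argument, because 1 / sqrt (8 m -
  l^2) equals 1 / (2 sqrt (2 m)) at l = 0; they differ in how the surface is presented, as a product
  or as a preimage under the projection.\<close>

lemma has_derivative_vec_iff:
  fixes f :: "'a::real_normed_vector \<Rightarrow> real ^ 'n"
  shows "(f has_derivative f') (at x within S) \<longleftrightarrow>
    (\<forall>i. ((\<lambda>x. f x $ i) has_derivative (\<lambda>h. f' h $ i)) (at x within S))"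
  by (subst has_derivative_componentwise_within) (force simp: Basis_vec_def inner_axis)

lemma sum_scaleR_axis: "(\<Sum>i\<in>UNIV. x $ i *\<^sub>R axis i 1) = (x :: real ^ 'n)"
  using basis_expansion[of x] by (simp add: scalar_mult_eq_scaleR)

lemma bilinear_axis_expansion:
  fixes f :: "real ^ 'm \<Rightarrow> real ^ 'n \<Rightarrow> real"
  assumes "bilinear f"
  shows "f u v = (\<Sum>i\<in>UNIV. \<Sum>j\<in>UNIV. f (axis i 1) (axis j 1) * u $ i * v $ j)"
proof -
  have "f u v = f (\<Sum>i\<in>UNIV. u $ i *\<^sub>R axis i 1) (\<Sum>j\<in>UNIV. v $ j *\<^sub>R axis j 1)"
    by (simp add: sum_scaleR_axis)
  also have "\<dots> = (\<Sum>(i, j)\<in>UNIV \<times> UNIV. f (u $ i *\<^sub>R axis i 1) (v $ j *\<^sub>R axis j 1))"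
    by (rule bilinear_sum[OF assms])
  also have "\<dots> = (\<Sum>i\<in>UNIV. \<Sum>j\<in>UNIV. f (axis i 1) (axis j 1) * u $ i * v $ j)"
    by (simp add: sum.cartesian_product bilinear_lmul[OF assms] bilinear_rmul[OF assms] mult_ac
        del: UNIV_Times_UNIV)
  finally show ?thesis .
qed

lemma matrix_inv_vector_mult:
  fixes A :: "real ^ 'n ^ 'n"
  assumes "invertible A" "A *v w = b"
  shows "matrix_inv A *v b = w"
proof -
  have "matrix_inv A ** A = mat 1"
    unfolding matrix_inv_def
    by (rule someI2_ex) (use assms(1) in \<open>auto simp: invertible_def\<close>)
  then show ?thesis
    using assms(2)[symmetric] by (simp add: matrix_vector_mul_assoc)
qed

text \<open>With \<open>dg a b r\<close> the derivative of g(a, b) in direction r, the right-hand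
  side of \<open>koszul\<close> is the Koszul expression for constant fields, whose brackets vanish.
  It prescribes the product of the Christoffel form with every r, and nondegeneracy makes the Gram
  matrix invertible, so a candidate w is certified without evaluating an inverse.\<close>

lemma christoffel_form_eqI:
  fixes g :: "'n::finite metric"
  assumes bil: "bilinear (g p)" and nondeg: "\<And>u. (\<And>r. g p r u = 0) \<Longrightarrow> u = 0"
    and dg: "\<And>a b. ((\<lambda>q. g q a b) has_derivative dg a b) (at p)"
    and bildg: "\<And>r. bilinear (\<lambda>a b. dg a b r)"
    and koszul: "\<And>r. 2 * g p r w = dg v r u + dg u r v - dg u v r"
  shows "christoffel_form g p u v = w"
proof -
  define K where "K r u v = dg v r u + dg u r v - dg u v r" for r u v
  have lin: "linear (dg a b)" for a b
    using dg has_derivative_linear by blast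
  have bilK: "bilinear (K r)" for r
    unfolding bilinear_def K_def
    by (intro conjI allI linearI)
      (auto simp: linear_add[OF lin] linear_scale[OF lin] bilinear_ladd[OF bildg]
        bilinear_radd[OF bildg] bilinear_lmul[OF bildg] bilinear_rmul[OF bildg] algebra_simps)
  have gp: "gram_partial g p i j k = dg (axis j 1) (axis k 1) (axis i 1)" for i j k
    unfolding gram_partial_def gram_def
    using frechet_derivative_at[OF dg, of "axis j 1" "axis k 1"] by simp
  have G: "gram g p *v b = (\<chi> r. g p (axis r 1) b)" for b
  proof -
    have "g p (axis r 1) b = g p (axis r 1) (\<Sum>j\<in>UNIV. b $ j *\<^sub>R axis j 1)" for r
      by (simp add: sum_scaleR_axis)
    also have "\<dots> r = (\<Sum>j\<in>UNIV. g p (axis r 1) (axis j 1) * b $ j)" for r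
      using bil unfolding bilinear_def by (simp add: linear_sum linear_scale mult_ac)
    finally show ?thesis
      by (simp add: gram_def matrix_vector_mult_def vec_eq_iff)
  qed
  have "inj ((*v) (gram g p))"
    unfolding linear_injective_0[OF matrix_vector_mul_linear]
  proof (intro allI impI)
    fix b assume "gram g p *v b = 0"
    then have *: "g p (axis r 1) b = 0" for r
      by (simp add: G vec_eq_iff)
    have "g p (\<Sum>i\<in>UNIV. r $ i *\<^sub>R axis i 1) b = 0" for r
    proof -
      have "linear (\<lambda>x. g p x b)"
        using bil by (simp add: bilinear_def)
      then show ?thesis
        by (simp add: linear_sum[of "\<lambda>x. g p x b"] linear_scale[of "\<lambda>x. g p x b"] *)
    qed
    then have "g p r b = 0" for r
      by (simp add: sum_scaleR_axis)
    then show "b = 0" by (rule nondeg)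
  qed
  then have inv: "invertible (gram g p)"
    by (simp add: invertible_left_inverse matrix_left_invertible_injective)
  have chr: "christoffel g p k i j =
      (\<Sum>r\<in>UNIV. matrix_inv (gram g p) $ k $ r * K (axis r 1) (axis i 1) (axis j 1)) / 2" for k i j
    by (simp add: christoffel_def gp K_def)
  have "christoffel_form g p u v = matrix_inv (gram g p) *v (\<chi> r. K (axis r 1) u v / 2)"
  proof (simp add: vec_eq_iff christoffel_form_def matrix_vector_mult_def, intro allI)
    fix k
    have "(\<Sum>i\<in>UNIV. \<Sum>j\<in>UNIV. christoffel g p k i j * u $ i * v $ j) =
      (\<Sum>i\<in>UNIV. \<Sum>j\<in>UNIV. \<Sum>r\<in>UNIV. matrix_inv (gram g p) $ k $ r *
         (K (axis r 1) (axis i 1) (axis j 1) * u $ i * v $ j) / 2)"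
      by (simp add: chr sum_divide_distrib sum_distrib_left sum_distrib_right mult_ac)
    also have "\<dots> = (\<Sum>i\<in>UNIV. \<Sum>r\<in>UNIV. \<Sum>j\<in>UNIV. matrix_inv (gram g p) $ k $ r *
         (K (axis r 1) (axis i 1) (axis j 1) * u $ i * v $ j) / 2)"
      by (intro sum.cong refl sum.swap)
    also have "\<dots> = (\<Sum>r\<in>UNIV. \<Sum>i\<in>UNIV. \<Sum>j\<in>UNIV. matrix_inv (gram g p) $ k $ r *
         (K (axis r 1) (axis i 1) (axis j 1) * u $ i * v $ j) / 2)"
      by (rule sum.swap)
    also have "\<dots> = (\<Sum>r\<in>UNIV. matrix_inv (gram g p) $ k $ r * K (axis r 1) u v / 2)"
      by (subst (2) bilinear_axis_expansion[OF bilK]) (simp add: sum_distrib_left sum_divide_distrib)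
    finally show "(\<Sum>i\<in>UNIV. \<Sum>j\<in>UNIV. christoffel g p k i j * u $ i * v $ j) =
       (\<Sum>r\<in>UNIV. matrix_inv (gram g p) $ k $ r * K (axis r 1) u v / 2)" by simp
  qed
  also have "\<dots> = w"
  proof (rule matrix_inv_vector_mult[OF inv])
    show "gram g p *v w = (\<chi> r. K (axis r 1) u v / 2)"
      unfolding G K_def koszul[symmetric] by simp
  qed
  finally show ?thesis .
qed

section \<open>Connection and curvature of the Bianchi-Cartan-Vranceanu spaces\<close>

definition bcv_conf :: "real \<Rightarrow> real ^ 3 \<Rightarrow> real" where
  "bcv_conf m p = 1 + m * ((p $ 1)\<^sup>2 + (p $ 2)\<^sup>2)"

text \<open>The usual orthonormal frame, with D the conformal factor: \<open>E\<^sub>1\<close> = D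
  d/dx - (l y / 2) d/dz, \<open>E\<^sub>2\<close> = D d/dy + (l x / 2) d/dz,
  \<open>E\<^sub>3\<close> = d/dz. It is encoded as the linear map from frame components to
  coordinate vectors.\<close>

definition bcv_frame :: "real \<Rightarrow> real \<Rightarrow> real ^ 3 \<Rightarrow> real ^ 3 \<Rightarrow> real ^ 3" where
  "bcv_frame m l p f =
     vector [bcv_conf m p * f $ 1, bcv_conf m p * f $ 2, f $ 3 - l / 2 * (p $ 2 * f $ 1 - p $ 1 * f $ 2)]"

definition bcv_coframe :: "real \<Rightarrow> real \<Rightarrow> real ^ 3 \<Rightarrow> real ^ 3 \<Rightarrow> real ^ 3" where
  "bcv_coframe m l p u = vector [u $ 1 / bcv_conf m p, u $ 2 / bcv_conf m p,
     u $ 3 + l / 2 * ((p $ 2 * u $ 1 - p $ 1 * u $ 2) / bcv_conf m p)]"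

lemma bcv_coframe_frame [simp]:
  "bcv_conf m p \<noteq> 0 \<Longrightarrow> bcv_coframe m l p (bcv_frame m l p f) = f"
  by (simp add: bcv_coframe_def bcv_frame_def vec_eq_iff forall_3 field_simps)

lemma bcv_frame_coframe [simp]:
  "bcv_conf m p \<noteq> 0 \<Longrightarrow> bcv_frame m l p (bcv_coframe m l p u) = u"
  by (simp add: bcv_coframe_def bcv_frame_def vec_eq_iff forall_3 field_simps)

lemma bcv_metric_eq_inner: "bcv_metric m l p u v = bcv_coframe m l p u \<bullet> bcv_coframe m l p v"
  by (simp add: bcv_metric_def bcv_coframe_def bcv_conf_def inner_vec_def sum_3 Let_def
      power2_eq_square add_divide_distrib)

text \<open>The differential, in a direction with frame components \<open>R\<close>, of the coframe components of a
  constant vector field having frame components \<open>U\<close> at \<open>p\<close>. The Christoffel form, connection and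
  curvature below are likewise expressed in frame components throughout, which makes them polynomial.\<close>

definition bcv_dcoframe :: "real \<Rightarrow> real \<Rightarrow> real ^ 3 \<Rightarrow> real ^ 3 \<Rightarrow> real ^ 3 \<Rightarrow> real ^ 3" where
  "bcv_dcoframe m l p U R =
     vector [- 2 * m * (p $ 1 * R $ 1 + p $ 2 * R $ 2) * U $ 1,
       - 2 * m * (p $ 1 * R $ 1 + p $ 2 * R $ 2) * U $ 2,
       l / 2 * bcv_conf m p * (R $ 2 * U $ 1 - R $ 1 * U $ 2)
         - l * m * (p $ 2 * U $ 1 - p $ 1 * U $ 2) * (p $ 1 * R $ 1 + p $ 2 * R $ 2)]"

lemma has_derivative_vec_nth: "((\<lambda>x. x $ i) has_derivative (\<lambda>h. h $ i)) (at p)"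
  by (rule bounded_linear_imp_has_derivative[OF bounded_linear_vec_nth])

lemma has_derivative_bcv_conf:
  "(bcv_conf m has_derivative (\<lambda>r. 2 * m * (p $ 1 * r $ 1 + p $ 2 * r $ 2))) (at p)"
  unfolding bcv_conf_def[abs_def]
  by (auto intro!: derivative_eq_intros has_derivative_vec_nth simp: algebra_simps)

lemma has_derivative_bcv_coframe:
  assumes "bcv_conf m p \<noteq> 0"
  shows "((\<lambda>q. bcv_coframe m l q u) has_derivative
    (\<lambda>r. bcv_dcoframe m l p (bcv_coframe m l p u) (bcv_coframe m l p r))) (at p)"
proof -
  note D = has_derivative_bcv_conf[of m p]
  have 1: "((\<lambda>q. u $ 1 / bcv_conf m q) has_derivative
      (\<lambda>r. bcv_dcoframe m l p (bcv_coframe m l p u) (bcv_coframe m l p r) $ 1)) (at p)"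
    using assms by (auto intro!: derivative_eq_intros D simp: bcv_dcoframe_def bcv_coframe_def field_simps)
  have 2: "((\<lambda>q. u $ 2 / bcv_conf m q) has_derivative
      (\<lambda>r. bcv_dcoframe m l p (bcv_coframe m l p u) (bcv_coframe m l p r) $ 2)) (at p)"
    using assms by (auto intro!: derivative_eq_intros D simp: bcv_dcoframe_def bcv_coframe_def field_simps)
  have 3: "((\<lambda>q. u $ 3 + l / 2 * ((q $ 2 * u $ 1 - q $ 1 * u $ 2) / bcv_conf m q)) has_derivative
      (\<lambda>r. bcv_dcoframe m l p (bcv_coframe m l p u) (bcv_coframe m l p r) $ 3)) (at p)"
    using assms
    by (auto intro!: derivative_eq_intros D has_derivative_vec_nth simp: bcv_dcoframe_def bcv_coframe_def field_simps)
  show ?thesis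
    unfolding has_derivative_vec_iff forall_3
    using 1 2 3 by (simp add: bcv_coframe_def)
qed

text \<open>Differentiates along U the field with constant coordinates whose frame components at p
  are V. It is symmetric in U and V because such fields commute.\<close>

definition bcv_gamma :: "real \<Rightarrow> real \<Rightarrow> real ^ 3 \<Rightarrow> real ^ 3 \<Rightarrow> real ^ 3 \<Rightarrow> real ^ 3" where
  "bcv_gamma m l p U V = vector [
     - 2 * m * (p $ 1 * (U $ 1 * V $ 1 - U $ 2 * V $ 2) + p $ 2 * (U $ 2 * V $ 1 + U $ 1 * V $ 2))
       + l / 2 * (V $ 3 * U $ 2 + U $ 3 * V $ 2),
     - 2 * m * (p $ 1 * (U $ 1 * V $ 2 + V $ 1 * U $ 2) + p $ 2 * (U $ 2 * V $ 2 - U $ 1 * V $ 1))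
       - l / 2 * (V $ 3 * U $ 1 + U $ 3 * V $ 1),
     - l * m / 2 * ((p $ 2 * V $ 1 - p $ 1 * V $ 2) * (p $ 1 * U $ 1 + p $ 2 * U $ 2)
       + (p $ 2 * U $ 1 - p $ 1 * U $ 2) * (p $ 1 * V $ 1 + p $ 2 * V $ 2))]"

lemma linear_bcv_coframe: "linear (bcv_coframe m l p)"
  by (intro linearI)
    (simp_all add: bcv_coframe_def vec_eq_iff forall_3 algebra_simps add_divide_distrib diff_divide_distrib)

lemma bcv_gamma_koszul:
  "2 * (R \<bullet> bcv_gamma m l p U V) =
    V \<bullet> bcv_dcoframe m l p R U + bcv_dcoframe m l p V U \<bullet> R
    + (U \<bullet> bcv_dcoframe m l p R V + bcv_dcoframe m l p U V \<bullet> R)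
    - (U \<bullet> bcv_dcoframe m l p V R + bcv_dcoframe m l p U R \<bullet> V)"
proof -
  \<comment> \<open>Writing l = 2 k removes the halves, so that both sides normalise to polynomials
    with integer coefficients.\<close>
  define k where "k = l / 2"
  have l: "l = 2 * k" by (simp add: k_def)
  show ?thesis
    unfolding l bcv_gamma_def bcv_dcoframe_def inner_vec_def sum_3 bcv_conf_def
    by (simp add: power2_eq_square algebra_simps)
qed

lemma bcv_christoffel_form:
  assumes D: "bcv_conf m p \<noteq> 0"
  shows "christoffel_form (bcv_metric m l) p u v =
    bcv_frame m l p (bcv_gamma m l p (bcv_coframe m l p u) (bcv_coframe m l p v))"
proof (rule christoffel_form_eqI)
  note lin = linear_add[OF linear_bcv_coframe] linear_scale[OF linear_bcv_coframe]
  show "bilinear (bcv_metric m l p)"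
    unfolding bilinear_def bcv_metric_eq_inner
    by (auto intro!: linearI simp: lin inner_add_left inner_add_right)
  show "u = 0" if "\<And>r. bcv_metric m l p r u = 0" for u
  proof -
    have "bcv_coframe m l p u = 0"
      using that[of u] by (simp add: bcv_metric_eq_inner)
    then have "u = bcv_frame m l p 0"
      using bcv_frame_coframe[OF D] by metis
    then show ?thesis by (simp add: bcv_frame_def vec_eq_iff forall_3)
  qed
  define \<theta> where "\<theta> = bcv_coframe m l p"
  define d where "d a b r = \<theta> a \<bullet> bcv_dcoframe m l p (\<theta> b) (\<theta> r) + bcv_dcoframe m l p (\<theta> a) (\<theta> r) \<bullet> \<theta> b" for a b r
  show "((\<lambda>q. bcv_metric m l q a b) has_derivative d a b) (at p)" for a b
    unfolding bcv_metric_eq_inner d_def \<theta>_def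
    by (intro has_derivative_inner has_derivative_bcv_coframe D)
  have ld: "linear (\<lambda>U. bcv_dcoframe m l p U R)" for R
    by (intro linearI) (simp_all add: lin bcv_dcoframe_def vec_eq_iff forall_3 algebra_simps)
  show "bilinear (\<lambda>a b. d a b r)" for r
    unfolding bilinear_def d_def
    by (auto intro!: linearI simp: \<theta>_def lin inner_add_left inner_add_right
        linear_add[OF ld] linear_scale[OF ld] algebra_simps)
  show "2 * bcv_metric m l p r (bcv_frame m l p (bcv_gamma m l p (bcv_coframe m l p u) (bcv_coframe m l p v)))
    = d v r u + d u r v - d u v r" for r
    unfolding bcv_metric_eq_inner bcv_coframe_frame[OF D] d_def \<theta>_def
    by (rule bcv_gamma_koszul)
qed

text \<open>In contrast to \<open>bcv_gamma\<close>, this differentiates along X a field with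
  constant frame components f. It is the connection form of an orthonormal frame, hence a skew map
  in f.\<close>

definition bcv_connection :: "real \<Rightarrow> real \<Rightarrow> real ^ 3 \<Rightarrow> real ^ 3 \<Rightarrow> real ^ 3 \<Rightarrow> real ^ 3" where
  "bcv_connection m l p X f = vector [
     - 2 * m * (p $ 2 * X $ 1 - p $ 1 * X $ 2) * f $ 2 + l / 2 * (X $ 3 * f $ 2 + X $ 2 * f $ 3),
     2 * m * (p $ 2 * X $ 1 - p $ 1 * X $ 2) * f $ 1 - l / 2 * (X $ 3 * f $ 1 + X $ 1 * f $ 3),
     l / 2 * (X $ 1 * f $ 2 - X $ 2 * f $ 1)]"

text \<open>The explicit vector is the product rule for the field with frame components f, in the
  direction with components X, where f has derivative f'. The identity trades coordinate derivative
  plus Christoffel form for component derivative plus connection form.\<close>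

lemma bcv_connection_gamma:
  "vector [
      2 * m * (p $ 1 * bcv_frame m l p X $ 1 + p $ 2 * bcv_frame m l p X $ 2) * f $ 1 + bcv_conf m p * f' $ 1,
      2 * m * (p $ 1 * bcv_frame m l p X $ 1 + p $ 2 * bcv_frame m l p X $ 2) * f $ 2 + bcv_conf m p * f' $ 2,
      f' $ 3 - l / 2 * (bcv_frame m l p X $ 2 * f $ 1 + p $ 2 * f' $ 1
        - bcv_frame m l p X $ 1 * f $ 2 - p $ 1 * f' $ 2)]
    + bcv_frame m l p (bcv_gamma m l p X f) = bcv_frame m l p (f' + bcv_connection m l p X f)"
proof -
  define k where "k = l / 2"
  have l: "l = 2 * k" by (simp add: k_def)
  show ?thesis
    unfolding l bcv_gamma_def bcv_frame_def bcv_connection_def bcv_conf_def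
    by (simp add: vec_eq_iff forall_3 power2_eq_square algebra_simps)
qed

lemma dmap_eqI:
  assumes "(f has_derivative f') (at p)" and "\<forall>\<^sub>F q in nhds p. g q = f q"
  shows "dmap g p = f'"
proof -
  have "(g has_derivative f') (at p)"
    by (rule has_derivative_transform_eventually[OF assms(1)])
      (use assms(2) in \<open>auto simp: eventually_at_filter dest: eventually_nhds_x_imp_x elim: eventually_mono\<close>)
  then show ?thesis
    unfolding dmap_def using frechet_derivative_at by metis
qed

text \<open>Since \<open>dmap\<close> sees only the germ of a field, V has to be given by the frame
  near p only. This matters for the tension field, whose formula is available only over I.\<close>

lemma cov_along_bcv:
  assumes D: "bcv_conf m (\<phi> p) \<noteq> 0"
    and \<phi>: "(\<phi> has_derivative \<phi>') (at p)" and f: "(f has_derivative f') (at p)"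
    and V: "\<forall>\<^sub>F q in nhds p. V q = bcv_frame m l (\<phi> q) (f q)"
  shows "cov_along (bcv_metric m l) \<phi> V p u = bcv_frame m l (\<phi> p)
    (f' u + bcv_connection m l (\<phi> p) (bcv_coframe m l (\<phi> p) (\<phi>' u)) (f p))"
proof -
  define X where "X = bcv_coframe m l (\<phi> p) (\<phi>' u)"
  have \<phi>'u: "\<phi>' u = bcv_frame m l (\<phi> p) X"
    unfolding X_def using D by simp
  have \<phi>i: "((\<lambda>q. \<phi> q $ i) has_derivative (\<lambda>h. \<phi>' h $ i)) (at p)" for i
    using \<phi> by (simp add: has_derivative_vec_iff)
  have fi: "((\<lambda>q. f q $ i) has_derivative (\<lambda>h. f' h $ i)) (at p)" for i
    using f by (simp add: has_derivative_vec_iff)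
  have "((\<lambda>q. bcv_frame m l (\<phi> q) (f q)) has_derivative (\<lambda>h. vector [
      2 * m * (\<phi> p $ 1 * \<phi>' h $ 1 + \<phi> p $ 2 * \<phi>' h $ 2) * f p $ 1 + bcv_conf m (\<phi> p) * f' h $ 1,
      2 * m * (\<phi> p $ 1 * \<phi>' h $ 1 + \<phi> p $ 2 * \<phi>' h $ 2) * f p $ 2 + bcv_conf m (\<phi> p) * f' h $ 2,
      f' h $ 3 - l / 2 * (\<phi>' h $ 2 * f p $ 1 + \<phi> p $ 2 * f' h $ 1 - \<phi>' h $ 1 * f p $ 2 - \<phi> p $ 1 * f' h $ 2)])) (at p)"
    unfolding has_derivative_vec_iff bcv_frame_def bcv_conf_def forall_3
    by (auto intro!: derivative_eq_intros \<phi>i fi simp: fun_eq_iff field_simps)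
  note dV = dmap_eqI[OF this V]
  have d\<phi>: "dmap \<phi> p = \<phi>'"
    using dmap_eqI[OF \<phi>] by simp
  have Vp: "V p = bcv_frame m l (\<phi> p) (f p)"
    using V by (rule eventually_nhds_x_imp_x)
  show ?thesis
    unfolding cov_along_def dV d\<phi> Vp bcv_christoffel_form[OF D] bcv_coframe_frame[OF D] X_def[symmetric]
    unfolding \<phi>'u bcv_connection_gamma ..
qed

section \<open>Curvature of the Bianchi-Cartan-Vranceanu metric\<close>

definition bcv_gamma_dpoint :: "real \<Rightarrow> real \<Rightarrow> real ^ 3 \<Rightarrow> real ^ 3 \<Rightarrow> real ^ 3 \<Rightarrow> real ^ 3 \<Rightarrow> real ^ 3" where
  "bcv_gamma_dpoint m l p r U V = vector [
     - 2 * m * (r $ 1 * (U $ 1 * V $ 1 - U $ 2 * V $ 2) + r $ 2 * (U $ 2 * V $ 1 + U $ 1 * V $ 2)),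
     - 2 * m * (r $ 1 * (U $ 1 * V $ 2 + V $ 1 * U $ 2) + r $ 2 * (U $ 2 * V $ 2 - U $ 1 * V $ 1)),
     - l * m / 2 * ((r $ 2 * V $ 1 - r $ 1 * V $ 2) * (p $ 1 * U $ 1 + p $ 2 * U $ 2)
       + (p $ 2 * V $ 1 - p $ 1 * V $ 2) * (r $ 1 * U $ 1 + r $ 2 * U $ 2)
       + (r $ 2 * U $ 1 - r $ 1 * U $ 2) * (p $ 1 * V $ 1 + p $ 2 * V $ 2)
       + (p $ 2 * U $ 1 - p $ 1 * U $ 2) * (r $ 1 * V $ 1 + r $ 2 * V $ 2))]"

lemma has_derivative_bcv_gamma:
  assumes U: "(U has_derivative U') (at p)" and V: "(V has_derivative V') (at p)"
  shows "((\<lambda>q. bcv_gamma m l q (U q) (V q)) has_derivative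
    (\<lambda>r. bcv_gamma_dpoint m l p r (U p) (V p) + bcv_gamma m l p (U' r) (V p)
      + bcv_gamma m l p (U p) (V' r))) (at p)"
proof -
  have Ui: "((\<lambda>q. U q $ i) has_derivative (\<lambda>h. U' h $ i)) (at p)" for i
    using U by (simp add: has_derivative_vec_iff)
  have Vi: "((\<lambda>q. V q $ i) has_derivative (\<lambda>h. V' h $ i)) (at p)" for i
    using V by (simp add: has_derivative_vec_iff)
  define k where "k = l / 2"
  have l: "l = 2 * k" by (simp add: k_def)
  show ?thesis
    unfolding has_derivative_vec_iff bcv_gamma_def bcv_gamma_dpoint_def forall_3 l
    by (auto intro!: derivative_eq_intros has_derivative_vec_nth Ui Vi simp: fun_eq_iff algebra_simps)
qed

text \<open>With \<open>W \<times> (U \<times> V) = (V \<bullet> W) U - (U \<bullet> W) V\<close>, the diagonal entries are the sectional curvatures of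
  the coordinate planes of the frame.\<close>

definition bcv_curvature :: "real \<Rightarrow> real \<Rightarrow> real ^ 3 \<Rightarrow> real ^ 3 \<Rightarrow> real ^ 3 \<Rightarrow> real ^ 3" where
  "bcv_curvature m l U V W = cross3 W (vector [l\<^sup>2 / 4 * cross3 U V $ 1, l\<^sup>2 / 4 * cross3 U V $ 2,
     (4 * m - 3 * l\<^sup>2 / 4) * cross3 U V $ 3])"

text \<open>Each half is an iterated covariant derivative of fields with constant coordinates: the
  inner one, \<open>bcv_gamma\<close>, varies through the base point and through both coframe
  arguments, and \<open>bcv_connection\<close> accounts for the frame. In the difference the
  dependence on p cancels.\<close>

lemma bcv_curvature_gamma:
  "bcv_gamma_dpoint m l p (bcv_frame m l p U) V W + bcv_gamma m l p (bcv_dcoframe m l p V U) W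
      + bcv_gamma m l p V (bcv_dcoframe m l p W U) + bcv_connection m l p U (bcv_gamma m l p V W)
    - (bcv_gamma_dpoint m l p (bcv_frame m l p V) U W + bcv_gamma m l p (bcv_dcoframe m l p U V) W
      + bcv_gamma m l p U (bcv_dcoframe m l p W V) + bcv_connection m l p V (bcv_gamma m l p U W))
    = bcv_curvature m l U V W"
proof -
  define k where "k = l / 2"
  have l: "l = 2 * k" by (simp add: k_def)
  show ?thesis
    unfolding l bcv_gamma_def bcv_gamma_dpoint_def bcv_frame_def bcv_connection_def bcv_conf_def
      bcv_curvature_def bcv_dcoframe_def cross3_def
    by (simp add: vec_eq_iff forall_3 power2_eq_square algebra_simps)
qed

lemma open_bcv_conf: "open {p. bcv_conf m p \<noteq> 0}"
  by (intro open_Collect_neq) (auto intro!: continuous_intros simp: bcv_conf_def)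

lemma bcv_frame_diff: "bcv_frame m l p (f - g) = bcv_frame m l p f - bcv_frame m l p g"
  by (simp add: bcv_frame_def vec_eq_iff forall_3 algebra_simps)

lemma bcv_curvature_at:
  assumes D: "bcv_conf m p \<noteq> 0"
  shows "curvature_at (bcv_metric m l) p u v w = bcv_frame m l p
    (bcv_curvature m l (bcv_coframe m l p u) (bcv_coframe m l p v) (bcv_coframe m l p w))"
proof -
  note const = dmap_eqI[OF has_derivative_const, of "\<lambda>_. c" c for c, simplified]
  define \<theta> where "\<theta> = bcv_coframe m l"
  have nested: "levi_civita (bcv_metric m l) (\<lambda>_. u) (levi_civita (bcv_metric m l) (\<lambda>_. v) (\<lambda>_. w)) p
    = bcv_frame m l p (bcv_gamma_dpoint m l p u (\<theta> p v) (\<theta> p w)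
      + bcv_gamma m l p (bcv_dcoframe m l p (\<theta> p v) (\<theta> p u)) (\<theta> p w)
      + bcv_gamma m l p (\<theta> p v) (bcv_dcoframe m l p (\<theta> p w) (\<theta> p u))
      + bcv_connection m l p (\<theta> p u) (bcv_gamma m l p (\<theta> p v) (\<theta> p w)))" for u v
  proof -
    define Y where "Y = levi_civita (bcv_metric m l) (\<lambda>_. v) (\<lambda>_. w)"
    have "\<forall>\<^sub>F q in nhds p. bcv_conf m q \<noteq> 0"
      using eventually_nhds_in_open[OF open_bcv_conf] D by simp
    then have "\<forall>\<^sub>F q in nhds p. Y q = bcv_frame m l q (bcv_gamma m l q (\<theta> q v) (\<theta> q w))"
      by eventually_elim (simp add: Y_def levi_civita_def const bcv_christoffel_form \<theta>_def)
    \<comment> \<open>A vector field is a field along the identity map, so the outer covariant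
      derivative is an instance of the pull-back formula.\<close>
    from cov_along_bcv[where \<phi> = "\<lambda>q. q" and V = Y and u = u, OF D has_derivative_ident
        has_derivative_bcv_gamma[OF has_derivative_bcv_coframe[OF D] has_derivative_bcv_coframe[OF D]]
        this[unfolded \<theta>_def]]
    have "cov_along (bcv_metric m l) (\<lambda>q. q) Y p u = bcv_frame m l p (bcv_gamma_dpoint m l p u (\<theta> p v) (\<theta> p w)
      + bcv_gamma m l p (bcv_dcoframe m l p (\<theta> p v) (\<theta> p u)) (\<theta> p w)
      + bcv_gamma m l p (\<theta> p v) (bcv_dcoframe m l p (\<theta> p w) (\<theta> p u))
      + bcv_connection m l p (\<theta> p u) (bcv_gamma m l p (\<theta> p v) (\<theta> p w)))"
      by (simp add: \<theta>_def)
    moreover have "dmap (\<lambda>q. q) p u = u"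
      using dmap_eqI[OF has_derivative_ident, of "\<lambda>q. q" p] by simp
    ultimately show ?thesis
      by (simp add: levi_civita_def[of _ _ Y] cov_along_def Y_def[symmetric])
  qed
  have "levi_civita (bcv_metric m l) (lie_bracket (\<lambda>_. u) (\<lambda>_. v)) (\<lambda>_. w) p = 0"
    using bcv_christoffel_form[OF D]
    by (simp add: levi_civita_def lie_bracket_def const)
      (simp add: bcv_frame_def bcv_gamma_def bcv_coframe_def vec_eq_iff forall_3)
  then show ?thesis
    unfolding curvature_at_def curvature_def nested
    using bcv_curvature_gamma[of m l p "\<theta> p u" "\<theta> p v" "\<theta> p w"] D
    by (simp add: \<theta>_def flip: bcv_frame_diff)
qed

section \<open>The bitension field of a Hopf cylinder\<close>

text \<open>The coframe du1, du2 + a du1 is orthonormal and has determinant 1, so the inverse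
  \<open>B\<close> of the Gram matrix is polynomial in a.\<close>

lemma metric_trace_2:
  fixes g :: "2 metric"
  assumes g: "\<And>u v. g p u v = u $ 1 * v $ 1 + (u $ 2 + a * u $ 1) * (v $ 2 + a * v $ 1)"
  shows "metric_trace g p b = b (axis 1 1) (axis 1 1) - a *\<^sub>R b (axis 1 1) (axis 2 1)
    - a *\<^sub>R b (axis 2 1) (axis 1 1) + (1 + a\<^sup>2) *\<^sub>R b (axis 2 1) (axis 2 1)"
proof -
  define B :: "real ^ 2 ^ 2" where "B = vector [vector [1, - a], vector [- a, 1 + a\<^sup>2]]"
  have "gram g p ** B = mat 1" "B ** gram g p = mat 1"
    by (simp_all add: gram_def g B_def matrix_matrix_mult_def mat_def vec_eq_iff forall_2 sum_2
        axis_def power2_eq_square algebra_simps)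
  then have "matrix_inv (gram g p) = B"
    unfolding matrix_inv_def
    by (intro some_equality) (metis matrix_mul_assoc matrix_mul_lid matrix_mul_rid)+
  then show ?thesis
    by (simp add: metric_trace_def sum_2 B_def)
qed

text \<open>The unit tangent is \<open>c E\<^sub>1 + \<sigma> E\<^sub>2\<close> and \<open>\<kappa>\<close> is the geodesic curvature in the base; the terms
  subtracted from \<open>\<kappa>\<close> come from the conformal factor.\<close>

locale bcv_curve =
  fixes m l :: real and I :: "real set" and \<alpha> :: "real \<Rightarrow> real ^ 2" and c \<sigma> \<kappa> \<kappa>1 \<kappa>2 :: "real \<Rightarrow> real"
  assumes open_I: "open I"
    and base: "\<And>s. s \<in> I \<Longrightarrow> \<alpha> s \<in> base_space m"
    and dx: "\<And>s. s \<in> I \<Longrightarrow> ((\<lambda>s. \<alpha> s $ 1) has_real_derivative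
      (1 + m * ((\<alpha> s $ 1)\<^sup>2 + (\<alpha> s $ 2)\<^sup>2)) * c s) (at s)"
    and dy: "\<And>s. s \<in> I \<Longrightarrow> ((\<lambda>s. \<alpha> s $ 2) has_real_derivative
      (1 + m * ((\<alpha> s $ 1)\<^sup>2 + (\<alpha> s $ 2)\<^sup>2)) * \<sigma> s) (at s)"
    and dc: "\<And>s. s \<in> I \<Longrightarrow> (c has_real_derivative
      - \<sigma> s * (\<kappa> s - 2 * m * (\<alpha> s $ 2 * c s - \<alpha> s $ 1 * \<sigma> s))) (at s)"
    and d\<sigma>: "\<And>s. s \<in> I \<Longrightarrow> (\<sigma> has_real_derivative
      c s * (\<kappa> s - 2 * m * (\<alpha> s $ 2 * c s - \<alpha> s $ 1 * \<sigma> s))) (at s)"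
    and unit: "\<And>s. s \<in> I \<Longrightarrow> (c s)\<^sup>2 + (\<sigma> s)\<^sup>2 = 1"
    and d\<kappa>: "\<And>s. s \<in> I \<Longrightarrow> (\<kappa> has_real_derivative \<kappa>1 s) (at s)"
    and d\<kappa>1: "\<And>s. s \<in> I \<Longrightarrow> (\<kappa>1 has_real_derivative \<kappa>2 s) (at s)"
begin

abbreviation "h \<equiv> bcv_metric m l"
abbreviation "\<phi> \<equiv> hopf_immersion \<alpha>"
abbreviation "g \<equiv> induced_metric h \<phi>"

text \<open>The height over the horizontal lift of \<open>\<alpha>\<close> is \<open>z + \<integral> tilt\<close>, so the induced metric is
  \<open>ds\<^sup>2 + (dz + tilt ds)\<^sup>2\<close>, which is flat.\<close>

definition tilt :: "real \<Rightarrow> real" where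
  "tilt s = l / 2 * (\<alpha> s $ 2 * c s - \<alpha> s $ 1 * \<sigma> s)"

text \<open>Derivative of \<open>tilt\<close>. The contributions of the derivatives of x and y
  cancel, being D c \<sigma> with opposite signs; only the rotation of (c, \<sigma>)
  remains.\<close>

definition dtilt :: "real \<Rightarrow> real" where
  "dtilt s = - l / 2 * (\<kappa> s - 2 * m * (\<alpha> s $ 2 * c s - \<alpha> s $ 1 * \<sigma> s))
     * (\<alpha> s $ 1 * c s + \<alpha> s $ 2 * \<sigma> s)"

text \<open>The rotation about \<open>E\<^sub>3\<close> that takes components in the frame T, N,
  \<open>E\<^sub>3\<close> to components in \<open>E\<^sub>1\<close>, \<open>E\<^sub>2\<close>,
  \<open>E\<^sub>3\<close>; \<open>frenet\<close> continues to coordinates.\<close>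

definition rot :: "real \<Rightarrow> real ^ 3 \<Rightarrow> real ^ 3" where
  "rot s f = vector [f $ 1 * c s - f $ 2 * \<sigma> s, f $ 1 * \<sigma> s + f $ 2 * c s, f $ 3]"

definition frenet :: "real ^ 2 \<Rightarrow> real ^ 3 \<Rightarrow> real ^ 3" where
  "frenet p f = bcv_frame m l (\<phi> p) (rot (p $ 1) f)"

lemma has_derivative_tilt: "s \<in> I \<Longrightarrow> (tilt has_real_derivative dtilt s) (at s)"
  unfolding tilt_def[abs_def] dtilt_def
  by (rule derivative_eq_intros dx dy dc d\<sigma> refl | assumption)+ (simp add: field_simps)

lemma conf_pos: "p $ 1 \<in> I \<Longrightarrow> bcv_conf m (\<phi> p) > 0"
  using base[of "p $ 1"] by (simp add: bcv_conf_def base_space_def hopf_immersion_def)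

lemma eventually_in_domain:
  fixes p :: "real ^ 2"
  assumes "p $ 1 \<in> I"
  shows "\<forall>\<^sub>F q in nhds p. q $ 1 \<in> I"
proof -
  have "open {p :: real ^ 2. p $ 1 \<in> I}"
  proof -
    have "continuous_on UNIV (\<lambda>p :: real ^ 2. p $ 1)"
      by (intro continuous_intros)
    from open_vimage[OF open_I this] show ?thesis
      by (simp add: vimage_def)
  qed
  then show ?thesis
    using assms eventually_nhds_in_open[of "{p :: real ^ 2. p $ 1 \<in> I}" p] by simp
qed

lemma frenet_diff: "frenet p (f - f') = frenet p f - frenet p f'"
  and frenet_add: "frenet p (f + f') = frenet p f + frenet p f'"
  and frenet_scale: "frenet p (r *\<^sub>R f) = r *\<^sub>R frenet p f"
  by (simp_all add: frenet_def bcv_frame_def rot_def vec_eq_iff forall_3 algebra_simps)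

lemma rot_inner: "s \<in> I \<Longrightarrow> rot s f \<bullet> rot s f' = f \<bullet> f'"
proof -
  assume s: "s \<in> I"
  have "rot s f \<bullet> rot s f' = ((c s)\<^sup>2 + (\<sigma> s)\<^sup>2) * (f $ 1 * f' $ 1 + f $ 2 * f' $ 2) + f $ 3 * f' $ 3"
    by (simp add: rot_def inner_vec_def sum_3 power2_eq_square algebra_simps)
  then show ?thesis
    by (simp add: unit[OF s] inner_vec_def sum_3)
qed

text \<open>Lets the vanishing of a vector along the cylinder be read as three scalar equations. The
  coframe undoes the frame, and the rotation preserves the inner product.\<close>

lemma frenet_eq_0_iff: "p $ 1 \<in> I \<Longrightarrow> frenet p f = 0 \<longleftrightarrow> f = 0"
proof
  assume p: "p $ 1 \<in> I" and "frenet p f = 0"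
  then have "bcv_coframe m l (\<phi> p) 0 = rot (p $ 1) f"
    using conf_pos[OF p] by (metis frenet_def bcv_coframe_frame less_irrefl)
  then have "rot (p $ 1) f = 0"
    by (simp add: linear_0[OF linear_bcv_coframe])
  then show "f = 0"
    using rot_inner[OF p, of f f] by simp
next
  show "f = 0 \<Longrightarrow> frenet p f = 0"
    using frenet_diff[of p 0 0] by simp
qed

text \<open>The horizontal lift of the tangent of \<alpha> differs from d/ds by a vertical vector,
  so d/ds goes to T + tilt \<open>E\<^sub>3\<close> and d/dz to \<open>E\<^sub>3\<close>.\<close>

lemma has_derivative_hopf_immersion:
  assumes p: "p $ 1 \<in> I"
  shows "(\<phi> has_derivative
    (\<lambda>u. frenet p (vector [u $ 1, 0, u $ 2 + tilt (p $ 1) * u $ 1]))) (at p)"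
proof -
  have "((\<lambda>p. \<alpha> (p $ 1) $ 1) has_derivative (\<lambda>u. bcv_conf m (\<phi> p) * c (p $ 1) * u $ 1)) (at p)"
    using has_derivative_compose[OF has_derivative_vec_nth dx[OF p, unfolded has_field_derivative_def]]
    by (simp add: bcv_conf_def hopf_immersion_def)
  moreover have "((\<lambda>p. \<alpha> (p $ 1) $ 2) has_derivative (\<lambda>u. bcv_conf m (\<phi> p) * \<sigma> (p $ 1) * u $ 1)) (at p)"
    using has_derivative_compose[OF has_derivative_vec_nth dy[OF p, unfolded has_field_derivative_def]]
    by (simp add: bcv_conf_def hopf_immersion_def)
  ultimately show ?thesis
    unfolding has_derivative_vec_iff forall_3
    by (auto simp: hopf_immersion_def frenet_def bcv_frame_def rot_def tilt_def field_simps
        intro!: has_derivative_vec_nth)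
qed

lemma dmap_hopf_immersion:
  "p $ 1 \<in> I \<Longrightarrow> dmap \<phi> p u = frenet p (vector [u $ 1, 0, u $ 2 + tilt (p $ 1) * u $ 1])"
  using dmap_eqI[OF has_derivative_hopf_immersion, of p \<phi>] by simp

lemma induced_metric_eq:
  assumes p: "p $ 1 \<in> I"
  shows "g p u v = u $ 1 * v $ 1 + (u $ 2 + tilt (p $ 1) * u $ 1) * (v $ 2 + tilt (p $ 1) * v $ 1)"
  using conf_pos[OF p]
  by (simp add: induced_metric_def dmap_hopf_immersion p bcv_metric_eq_inner frenet_def rot_inner)
    (simp add: inner_vec_def sum_3)

lemma metric_trace_induced:
  assumes p: "p $ 1 \<in> I"
  shows "metric_trace g p b = b (axis 1 1) (axis 1 1) - tilt (p $ 1) *\<^sub>R b (axis 1 1) (axis 2 1)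
    - tilt (p $ 1) *\<^sub>R b (axis 2 1) (axis 1 1) + (1 + (tilt (p $ 1))\<^sup>2) *\<^sub>R b (axis 2 1) (axis 2 1)"
  by (rule metric_trace_2) (rule induced_metric_eq[OF p])

text \<open>The coordinates (s, z) arise from Euclidean ones by the shear that adds the integral of
  \<open>tilt\<close> to z. A shear leaves one Christoffel symbol, the second derivative of the
  added function.\<close>

lemma induced_christoffel_form:
  assumes p: "p $ 1 \<in> I"
  shows "christoffel_form g p u v = vector [0, dtilt (p $ 1) * u $ 1 * v $ 1]"
proof (rule christoffel_form_eqI)
  define a where "a = tilt (p $ 1)"
  define a' where "a' = dtilt (p $ 1)"
  note gp = induced_metric_eq[OF p, folded a_def]
  show "bilinear (g p)"
    unfolding bilinear_def gp by (auto intro!: linearI simp: algebra_simps)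
  show "u = 0" if "\<And>r. g p r u = 0" for u
    using that[of "axis 1 1"] that[of "axis 2 1"]
    by (simp add: gp axis_def vec_eq_iff forall_2)
  define d where "d u v r = a' * r $ 1 * (u $ 1 * (v $ 2 + a * v $ 1) + (u $ 2 + a * u $ 1) * v $ 1)"
    for u v r :: "real ^ 2"
  have da: "((\<lambda>q. tilt (q $ 1)) has_derivative (\<lambda>r. a' * r $ 1)) (at p)"
    using has_derivative_compose[OF has_derivative_vec_nth
        has_derivative_tilt[OF p, unfolded has_field_derivative_def]]
    by (simp add: a'_def)
  show "((\<lambda>q. g q u v) has_derivative d u v) (at p)" for u v
  proof (rule has_derivative_transform_eventually)
    show "((\<lambda>q. u $ 1 * v $ 1 + (u $ 2 + tilt (q $ 1) * u $ 1) * (v $ 2 + tilt (q $ 1) * v $ 1))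
        has_derivative d u v) (at p)"
      by (auto intro!: derivative_eq_intros da simp: d_def fun_eq_iff a_def algebra_simps)
    show "\<forall>\<^sub>F q in at p. u $ 1 * v $ 1 + (u $ 2 + tilt (q $ 1) * u $ 1) * (v $ 2 + tilt (q $ 1) * v $ 1)
        = g q u v"
      using eventually_in_domain[OF p] unfolding eventually_at_filter
      by eventually_elim (simp add: induced_metric_eq)
  qed (simp_all add: induced_metric_eq p)
  show "bilinear (\<lambda>u v. d u v r)" for r
    unfolding bilinear_def d_def by (auto intro!: linearI simp: algebra_simps)
  show "2 * g p r (vector [0, dtilt (p $ 1) * u $ 1 * v $ 1]) = d v r u + d u r v - d u v r" for r
    by (simp add: gp d_def a'_def algebra_simps)
qed

lemma levi_civita_induced:
  "p $ 1 \<in> I \<Longrightarrow> levi_civita g (\<lambda>_. u) (\<lambda>_. v) p = vector [0, dtilt (p $ 1) * u $ 1 * v $ 1]"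
  by (simp add: levi_civita_def induced_christoffel_form dmap_eqI[OF has_derivative_const])

text \<open>The Frenet equations of the cylinder. Along T, the fields T, N, \<open>E\<^sub>3\<close>
  have derivatives \<kappa> N, - \<kappa> T + (l/2) \<open>E\<^sub>3\<close>, - (l/2) N; along
  \<open>E\<^sub>3\<close> they have - (l/2) N, (l/2) T, 0. The number A is the vertical component
  of the direction.\<close>

lemma cov_along_frenet:
  assumes p: "p $ 1 \<in> I"
    and f: "\<And>i. ((\<lambda>s. f s $ i) has_real_derivative f' $ i) (at (p $ 1))"
    and V: "\<And>q. q $ 1 \<in> I \<Longrightarrow> V q = frenet q (f (q $ 1))"
    and A: "A = u $ 2 + tilt (p $ 1) * u $ 1"
  shows "cov_along h \<phi> V p u = frenet p (vector [
      u $ 1 * f' $ 1 - (u $ 1 * \<kappa> (p $ 1) - l / 2 * A) * f (p $ 1) $ 2,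
      u $ 1 * f' $ 2 + (u $ 1 * \<kappa> (p $ 1) - l / 2 * A) * f (p $ 1) $ 1 - l / 2 * u $ 1 * f (p $ 1) $ 3,
      u $ 1 * f' $ 3 + l / 2 * u $ 1 * f (p $ 1) $ 2])"
proof -
  define s where "s = p $ 1"
  have s: "s \<in> I" using p by (simp add: s_def)
  \<comment> \<open>The rotation speed of (c, \<sigma>) relative to \<open>E\<^sub>1\<close>,
    \<open>E\<^sub>2\<close>; the turning of that frame itself makes up the difference to
    \<kappa>.\<close>
  define w where "w = \<kappa> s - 2 * m * (\<alpha> s $ 2 * c s - \<alpha> s $ 1 * \<sigma> s)"
  define F where "F = rot s f' + vector [- (f s $ 1) * \<sigma> s * w - f s $ 2 * c s * w,
     f s $ 1 * c s * w - f s $ 2 * \<sigma> s * w, 0]"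
  have "((\<lambda>s. rot s (f s) $ i) has_real_derivative F $ i) (at s)" for i
  proof -
    have "\<forall>i. ((\<lambda>s. rot s (f s) $ i) has_real_derivative F $ i) (at s)"
      unfolding forall_3 rot_def F_def
      by (auto intro!: derivative_eq_intros f[folded s_def] dc[OF s, folded w_def] d\<sigma>[OF s, folded w_def]
          simp: algebra_simps)
    then show ?thesis by blast
  qed
  then have "((\<lambda>q. rot (q $ 1) (f (q $ 1)) $ i) has_derivative (\<lambda>u. u $ 1 * F $ i)) (at p)" for i
    using has_derivative_compose[OF has_derivative_vec_nth[of 1 p]]
    by (fastforce simp: has_field_derivative_def s_def mult.commute)
  then have R: "((\<lambda>q. rot (q $ 1) (f (q $ 1))) has_derivative (\<lambda>u. u $ 1 *\<^sub>R F)) (at p)"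
    by (simp add: has_derivative_vec_iff)
  have "\<forall>\<^sub>F q in nhds p. V q = bcv_frame m l (\<phi> q) (rot (q $ 1) (f (q $ 1)))"
    using eventually_in_domain[OF p] by eventually_elim (simp add: V frenet_def)
  from cov_along_bcv[OF _ has_derivative_hopf_immersion[OF p] R this]
  have "cov_along h \<phi> V p u = bcv_frame m l (\<phi> p) (u $ 1 *\<^sub>R F + bcv_connection m l (\<phi> p)
      (rot s (vector [u $ 1, 0, A])) (rot s (f s)))"
    using conf_pos[OF p] by (simp add: s_def frenet_def A)
  also have "u $ 1 *\<^sub>R F + bcv_connection m l (\<phi> p) (rot s (vector [u $ 1, 0, A])) (rot s (f s)) =
    rot s (vector [
      u $ 1 * f' $ 1 - (u $ 1 * \<kappa> s - l / 2 * A) * f s $ 2,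
      u $ 1 * f' $ 2 + (u $ 1 * \<kappa> s - l / 2 * A) * f s $ 1 - l / 2 * u $ 1 * f s $ 3,
      u $ 1 * f' $ 3 + l / 2 * u $ 1 * f s $ 2])"
  proof -
    have \<kappa>: "\<kappa> s = w + 2 * m * (\<alpha> s $ 2 * c s - \<alpha> s $ 1 * \<sigma> s)"
      by (simp add: w_def)
    have \<phi>: "\<phi> p $ 1 = \<alpha> s $ 1" "\<phi> p $ 2 = \<alpha> s $ 2"
      by (simp_all add: hopf_immersion_def s_def)
    \<comment> \<open>The vertical component contains the planar cross product of two rotated
      vectors, which produces the factor c^2 + \<sigma>^2.\<close>
    have "u $ 1 * f s $ 2 = ((c s)\<^sup>2 + (\<sigma> s)\<^sup>2) * (u $ 1 * f s $ 2)"
      by (simp add: unit[OF s])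
    then show ?thesis
      unfolding F_def rot_def bcv_connection_def \<kappa> \<phi>
      by (simp add: vec_eq_iff forall_3 algebra_simps power2_eq_square)
  qed
  finally show ?thesis by (simp add: frenet_def s_def)
qed

text \<open>The second fundamental form has entries \<kappa> on (T, T), - l/2 on (T,
  \<open>E\<^sub>3\<close>) and 0 on (\<open>E\<^sub>3\<close>, \<open>E\<^sub>3\<close>). The
  tangential term with \<open>dtilt\<close> is cancelled by the induced connection.\<close>

lemma nabla_dmap_hopf_immersion:
  assumes p: "p $ 1 \<in> I"
  shows "nabla_dmap g h \<phi> p u v = frenet p (vector [0, u $ 1 * v $ 1 * \<kappa> (p $ 1)
    - l / 2 * ((u $ 2 + tilt (p $ 1) * u $ 1) * v $ 1 + u $ 1 * (v $ 2 + tilt (p $ 1) * v $ 1)), 0])"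
proof -
  define f :: "real \<Rightarrow> real ^ 3" where "f s = vector [v $ 1, 0, v $ 2 + tilt s * v $ 1]" for s
  have "\<forall>i. ((\<lambda>s. f s $ i) has_real_derivative
      (vector [0, 0, dtilt (p $ 1) * v $ 1] :: real ^ 3) $ i) (at (p $ 1))"
    unfolding forall_3 f_def by (auto intro!: derivative_eq_intros has_derivative_tilt p)
  then have "\<And>i. ((\<lambda>s. f s $ i) has_real_derivative
      (vector [0, 0, dtilt (p $ 1) * v $ 1] :: real ^ 3) $ i) (at (p $ 1))" by blast
  from cov_along_frenet[OF p this, where V = "\<lambda>q. dmap \<phi> q v" and u = u, OF _ refl]
  show ?thesis
    unfolding nabla_dmap_def levi_civita_induced[OF p]
    by (simp add: dmap_hopf_immersion p f_def flip: frenet_diff)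
      (simp add: frenet_def rot_def bcv_frame_def vec_eq_iff forall_3 field_simps)
qed

lemma tension_field_hopf_immersion:
  assumes p: "p $ 1 \<in> I"
  shows "tension_field g h \<phi> p = frenet p (vector [0, \<kappa> (p $ 1), 0])"
  unfolding tension_field_def metric_trace_induced[OF p] nabla_dmap_hopf_immersion[OF p]
  by (simp add: axis_def flip: frenet_diff frenet_add frenet_scale)
    (simp add: frenet_def rot_def bcv_frame_def vec_eq_iff forall_3 power2_eq_square field_simps)

lemma cov_tension_field:
  assumes p: "p $ 1 \<in> I"
  shows "cov_along h \<phi> (tension_field g h \<phi>) p v = frenet p (vector [
      - ((v $ 1 * \<kappa> (p $ 1) - l / 2 * (v $ 2 + tilt (p $ 1) * v $ 1)) * \<kappa> (p $ 1)),
      v $ 1 * \<kappa>1 (p $ 1), l / 2 * v $ 1 * \<kappa> (p $ 1)])"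
proof -
  define f :: "real \<Rightarrow> real ^ 3" where "f s = vector [0, \<kappa> s, 0]" for s
  have "\<forall>i. ((\<lambda>s. f s $ i) has_real_derivative (vector [0, \<kappa>1 (p $ 1), 0] :: real ^ 3) $ i) (at (p $ 1))"
    unfolding forall_3 f_def by (auto intro!: d\<kappa> p)
  then have "\<And>i. ((\<lambda>s. f s $ i) has_real_derivative
      (vector [0, \<kappa>1 (p $ 1), 0] :: real ^ 3) $ i) (at (p $ 1))" by blast
  from cov_along_frenet[OF p this, where V = "tension_field g h \<phi>" and u = v, OF _ refl]
  show ?thesis
    by (simp add: tension_field_hopf_immersion f_def)
qed

text \<open>The first derivative again has components that depend on s alone, so the Frenet
  equations apply a second time. The \<open>dtilt\<close> term goes away once the bitension field
  subtracts the induced connection.\<close>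

lemma second_cov_tension_field:
  assumes p: "p $ 1 \<in> I"
  shows "cov_along h \<phi> (\<lambda>q. cov_along h \<phi> (tension_field g h \<phi>) q v) p u = frenet p
   (let k = \<kappa> (p $ 1); k1 = \<kappa>1 (p $ 1); k2 = \<kappa>2 (p $ 1);
        U = u $ 1 * k - l / 2 * (u $ 2 + tilt (p $ 1) * u $ 1);
        V = v $ 1 * k - l / 2 * (v $ 2 + tilt (p $ 1) * v $ 1) in vector [
      - u $ 1 * ((v $ 1 * k1 - l / 2 * dtilt (p $ 1) * v $ 1) * k + V * k1) - U * v $ 1 * k1,
      u $ 1 * v $ 1 * k2 - U * V * k - l\<^sup>2 / 4 * u $ 1 * v $ 1 * k,
      l * u $ 1 * v $ 1 * k1])"
proof -
  define s where "s = p $ 1"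
  have s: "s \<in> I" using p by (simp add: s_def)
  define f :: "real \<Rightarrow> real ^ 3" where "f s = vector [
      - ((v $ 1 * \<kappa> s - l / 2 * (v $ 2 + tilt s * v $ 1)) * \<kappa> s),
      v $ 1 * \<kappa>1 s, l / 2 * v $ 1 * \<kappa> s]" for s
  define f' :: "real ^ 3" where "f' = vector [
      - ((v $ 1 * \<kappa>1 s - l / 2 * dtilt s * v $ 1) * \<kappa> s
        + (v $ 1 * \<kappa> s - l / 2 * (v $ 2 + tilt s * v $ 1)) * \<kappa>1 s),
      v $ 1 * \<kappa>2 s, l / 2 * v $ 1 * \<kappa>1 s]"
  have "\<forall>i. ((\<lambda>s. f s $ i) has_real_derivative f' $ i) (at s)"
    unfolding forall_3 f_def f'_def
    by (auto intro!: derivative_eq_intros d\<kappa> d\<kappa>1 has_derivative_tilt s simp: field_simps)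
  then have "\<And>i. ((\<lambda>s. f s $ i) has_real_derivative f' $ i) (at (p $ 1))"
    unfolding s_def by blast
  note df = this
  have "cov_along h \<phi> (\<lambda>q. cov_along h \<phi> (tension_field g h \<phi>) q v) p u = frenet p (vector [
      u $ 1 * f' $ 1 - (u $ 1 * \<kappa> s - l / 2 * (u $ 2 + tilt s * u $ 1)) * f s $ 2,
      u $ 1 * f' $ 2 + (u $ 1 * \<kappa> s - l / 2 * (u $ 2 + tilt s * u $ 1)) * f s $ 1 - l / 2 * u $ 1 * f s $ 3,
      u $ 1 * f' $ 3 + l / 2 * u $ 1 * f s $ 2])"
    unfolding s_def
    by (rule cov_along_frenet[OF p df _ refl]) (simp add: cov_tension_field f_def)
  then show ?thesis
    unfolding Let_def s_def[symmetric]
    by (elim trans, intro arg_cong[of _ _ "frenet p"])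
      (simp add: f_def f'_def vec_eq_iff forall_3 power2_eq_square algebra_simps)
qed

text \<open>\<open>bcv_curvature\<close> commutes with rotations about \<open>E\<^sub>3\<close>:
  these preserve cross products, and the first two of the diagonal entries agree. It can therefore
  be evaluated on components in T, N, \<open>E\<^sub>3\<close>.\<close>

lemma curvature_tension_field:
  assumes p: "p $ 1 \<in> I"
  shows "curvature_at h (\<phi> p) (dmap \<phi> p u) (tension_field g h \<phi> p) (dmap \<phi> p v) =
    frenet p (let A = u $ 2 + tilt (p $ 1) * u $ 1; B = v $ 2 + tilt (p $ 1) * v $ 1 in
      vector [0, - \<kappa> (p $ 1) * ((4 * m - 3 * l\<^sup>2 / 4) * u $ 1 * v $ 1 + l\<^sup>2 / 4 * A * B), 0])"
proof -
  define s where "s = p $ 1"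
  have s: "s \<in> I" using p by (simp add: s_def)
  have cross: "cross3 (rot s x) (rot s y) = rot s (cross3 x y)" for x y
  proof -
    have "cross3 (rot s x) (rot s y) $ 3 = ((c s)\<^sup>2 + (\<sigma> s)\<^sup>2) * (x $ 1 * y $ 2 - x $ 2 * y $ 1)"
      by (simp add: rot_def cross3_def power2_eq_square algebra_simps)
    then show ?thesis
      by (simp add: unit[OF s]) (simp add: vec_eq_iff forall_3 rot_def cross3_def algebra_simps)
  qed
  have diag: "(vector [a * rot s x $ 1, a * rot s x $ 2, b * rot s x $ 3] :: real ^ 3) =
     rot s (vector [a * x $ 1, a * x $ 2, b * x $ 3])" for a b x
    by (simp add: vec_eq_iff forall_3 rot_def algebra_simps)
  have "bcv_curvature m l (rot s x) (rot s y) (rot s z) = rot s (bcv_curvature m l x y z)"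
    for x y z
    unfolding bcv_curvature_def cross diag ..
  with conf_pos[OF p] have "curvature_at h (\<phi> p) (frenet p x) (frenet p y) (frenet p z)
      = frenet p (bcv_curvature m l x y z)" for x y z
    by (simp add: bcv_curvature_at frenet_def s_def)
  then show ?thesis
    unfolding dmap_hopf_immersion[OF p] tension_field_hopf_immersion[OF p]
    by (simp add: bcv_curvature_def cross3_def Let_def algebra_simps)
qed

text \<open>The normal part is \<kappa>'' + \<kappa> (Ric(N, N) - |A|^2) with A the second
  fundamental form. Here Ric(N, N) = 4 m - l^2 / 2, and |A|^2 = \<kappa>^2 + l^2 / 2 from the two
  mixed entries; together they give the constant 4 m - l^2.\<close>

lemma bitension_field_hopf_immersion:
  assumes p: "p $ 1 \<in> I"
  shows "bitension_field g h \<phi> p = frenet p (vector [- 3 * \<kappa> (p $ 1) * \<kappa>1 (p $ 1),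
    \<kappa>2 (p $ 1) - (\<kappa> (p $ 1)) ^ 3 + \<kappa> (p $ 1) * (4 * m - l\<^sup>2), l * \<kappa>1 (p $ 1)])"
  unfolding bitension_field_def metric_trace_induced[OF p] levi_civita_induced[OF p]
    second_cov_tension_field[OF p] cov_tension_field[OF p] curvature_tension_field[OF p] Let_def
  by (simp add: axis_def flip: frenet_diff frenet_add frenet_scale)
    (simp add: frenet_def rot_def bcv_frame_def vec_eq_iff forall_3 power2_eq_square power3_eq_cube field_simps)

lemma proper_biharmonic_iff:
  "proper_biharmonic_surface (hopf_domain I) h \<phi> \<longleftrightarrow>
    (\<forall>s\<in>I. \<kappa> s * \<kappa>1 s = 0 \<and> \<kappa>2 s - (\<kappa> s) ^ 3 + \<kappa> s * (4 * m - l\<^sup>2) = 0 \<and> l * \<kappa>1 s = 0)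
    \<and> (\<exists>s\<in>I. \<kappa> s \<noteq> 0)"
proof -
  have z: "(vector [a, b, c] :: real ^ 3) = 0 \<longleftrightarrow> a = 0 \<and> b = 0 \<and> c = 0" for a b c :: real
    by (simp add: vec_eq_iff forall_3)
  have dom: "(\<forall>p\<in>hopf_domain I. P (p $ 1)) \<longleftrightarrow> (\<forall>s\<in>I. P s)" for P
  proof safe
    fix s assume "\<forall>p\<in>hopf_domain I. P (p $ 1)" "s \<in> I"
    moreover from this have "vector [s, 0] \<in> hopf_domain I"
      by (simp add: hopf_domain_def)
    ultimately show "P s"
      by (metis vector_2(1))
  qed (simp add: hopf_domain_def)
  have "biharmonic_on (hopf_domain I) g h \<phi> \<longleftrightarrow> (\<forall>p\<in>hopf_domain I. \<kappa> (p $ 1) * \<kappa>1 (p $ 1) = 0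
    \<and> \<kappa>2 (p $ 1) - (\<kappa> (p $ 1)) ^ 3 + \<kappa> (p $ 1) * (4 * m - l\<^sup>2) = 0 \<and> l * \<kappa>1 (p $ 1) = 0)"
    unfolding biharmonic_on_def hopf_domain_def
    by (auto simp: bitension_field_hopf_immersion frenet_eq_0_iff z)
  moreover have "mean_curvature_vector h \<phi> p = (1 / 2) *\<^sub>R tension_field g h \<phi> p" for p
    by (simp add: mean_curvature_vector_def tension_field_def)
  then have "minimal_immersion (hopf_domain I) h \<phi> \<longleftrightarrow> (\<forall>p\<in>hopf_domain I. \<kappa> (p $ 1) = 0)"
    unfolding minimal_immersion_def hopf_domain_def
    by (auto simp: tension_field_hopf_immersion frenet_eq_0_iff z)
  ultimately show ?thesis
    using dom[of "\<lambda>s. \<kappa> s * \<kappa>1 s = 0 \<and> \<kappa>2 s - (\<kappa> s) ^ 3 + \<kappa> s * (4 * m - l\<^sup>2) = 0 \<and> l * \<kappa>1 s = 0"]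
      dom[of "\<lambda>s. \<kappa> s = 0"]
    by (simp add: proper_biharmonic_surface_def)
qed

end

section \<open>Circles in the sphere\<close>

lemma orthogonal_frame_3:
  fixes z :: "real ^ 3"
  assumes "a \<noteq> 0" "b \<noteq> 0" "c \<noteq> 0" "a \<bullet> b = 0" "a \<bullet> c = 0" "b \<bullet> c = 0"
    and z: "z \<bullet> a = 0" "z \<bullet> b = 0" "z \<bullet> c = 0"
  shows "z = 0"
proof (rule ccontr)
  assume "z \<noteq> 0"
  let ?S = "{z, a, b, c}"
  have "pairwise orthogonal ?S"
    using assms by (auto simp: pairwise_def orthogonal_def inner_commute)
  then have "independent ?S"
    by (rule pairwise_orthogonal_independent) (use assms \<open>z \<noteq> 0\<close> in auto)
  then have "card ?S \<le> 3"
    using independent_bound by fastforce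
  moreover have "card ?S = 4"
    using assms \<open>z \<noteq> 0\<close> by (auto simp: card_insert_if)
  ultimately show False by simp
qed

lemma constant_imp_derivative_0:
  fixes f :: "real \<Rightarrow> real"
  assumes "(f has_real_derivative f') (at s)" "open I" "s \<in> I" "\<And>t. t \<in> I \<Longrightarrow> f t = k"
  shows "f' = 0"
proof -
  have "((\<lambda>_. k) has_real_derivative f') (at s)"
    by (rule has_field_derivative_transform_within_open[OF assms(1-3)]) (use assms(4) in auto)
  then show ?thesis
    using DERIV_unique DERIV_const by blast
qed

lemma has_real_derivative_inner:
  assumes "(f has_vector_derivative f') (at s)"
  shows "((\<lambda>t. n \<bullet> f t) has_real_derivative n \<bullet> f') (at s)"
  using bounded_linear.has_vector_derivative[OF bounded_linear_inner_right assms, of n]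
  by (simp add: has_real_derivative_iff_has_vector_derivative)

text \<open>Near a point of the curve the circle is a graph over its tangent line. The projection h
  of the curve to that line has positive derivative at s0, so by the intermediate value theorem it
  attains every value near h(s0), and each point of the circle nearby is hit.\<close>

lemma open_image_in_circle:
  fixes \<psi> \<psi>' :: "real \<Rightarrow> real ^ 3"
  assumes C: "C = {x. n \<bullet> (x - c) = 0 \<and> dist c x = R}" and n: "norm n = 1" and R: "R > 0"
    and I: "open I" and \<psi>: "\<And>s. s \<in> I \<Longrightarrow> (\<psi> has_vector_derivative \<psi>' s) (at s)"
    and nz: "\<And>s. s \<in> I \<Longrightarrow> \<psi>' s \<noteq> 0" and sub: "\<psi> ` I \<subseteq> C"
  shows "openin (top_of_set C) (\<psi> ` I)"
proof (subst openin_subopen, intro ballI)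
  fix y assume "y \<in> \<psi> ` I"
  then obtain s0 where s0: "s0 \<in> I" and y: "y = \<psi> s0" by blast
  define e1 where "e1 = \<psi> s0 - c"
  define e2 where "e2 = \<psi>' s0"
  have plane: "n \<bullet> \<psi> s = n \<bullet> c" and circ: "(\<psi> s - c) \<bullet> (\<psi> s - c) = R\<^sup>2" if "s \<in> I" for s
  proof -
    have "\<psi> s \<in> C" using sub that by blast
    then show "n \<bullet> \<psi> s = n \<bullet> c" "(\<psi> s - c) \<bullet> (\<psi> s - c) = R\<^sup>2"
      using R by (auto simp: C inner_diff_right dist_norm norm_minus_commute dot_square_norm)
  qed
  have ne2: "n \<bullet> e2 = 0"
    unfolding e2_def
    by (rule constant_imp_derivative_0[OF has_real_derivative_inner[OF \<psi>[OF s0]] I s0 plane])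
  have e12: "e1 \<bullet> e2 = 0"
  proof -
    have "((\<lambda>s. (\<psi> s - c) \<bullet> (\<psi> s - c)) has_vector_derivative
        (\<psi> s0 - c) \<bullet> (\<psi>' s0 - 0) + (\<psi>' s0 - 0) \<bullet> (\<psi> s0 - c)) (at s0)"
      by (intro bounded_bilinear.has_vector_derivative[OF bounded_bilinear_inner]
          has_vector_derivative_diff \<psi> s0 has_vector_derivative_const)
    then have "2 * (e1 \<bullet> e2) = 0"
      unfolding has_real_derivative_iff_has_vector_derivative[symmetric]
      using constant_imp_derivative_0[OF _ I s0 circ]
      by (fastforce simp: e1_def e2_def inner_commute)
    then show ?thesis by simp
  qed
  have ne1: "n \<bullet> e1 = 0"
    using plane[OF s0] by (simp add: e1_def inner_diff_right)
  have e1R: "e1 \<bullet> e1 = R\<^sup>2"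
    using circ[OF s0] by (simp add: e1_def)
  have nonzero: "n \<noteq> 0" "e1 \<noteq> 0" "e2 \<noteq> 0"
    using n e1R R nz[OF s0] by (auto simp: e2_def)
  \<comment> \<open>On the half of the circle facing e1, the coordinate along e2 determines the
    point: two such points differ by t e1, and their equal distance to c makes t times a positive
    number vanish.\<close>
  have unique: "x = x'" if "x \<in> C" "x' \<in> C" and eq: "(x - c) \<bullet> e2 = (x' - c) \<bullet> e2"
    and pos: "(x - c) \<bullet> e1 > 0" "(x' - c) \<bullet> e1 > 0" for x x'
  proof -
    define t where "t = ((x - x') \<bullet> e1) / (e1 \<bullet> e1)"
    have "(x - x') - t *\<^sub>R e1 = 0"
    proof (rule orthogonal_frame_3[OF nonzero ne1 ne2 e12])
      show "(x - x' - t *\<^sub>R e1) \<bullet> n = 0"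
        using that(1,2) ne1 by (simp add: C inner_diff_left inner_diff_right inner_commute)
      show "(x - x' - t *\<^sub>R e1) \<bullet> e1 = 0"
        using nonzero(2) by (simp add: t_def inner_diff_left)
      show "(x - x' - t *\<^sub>R e1) \<bullet> e2 = 0"
        using eq e12 by (simp add: inner_diff_left)
    qed
    then have x: "x - c = (x' - c) + t *\<^sub>R e1" by (simp add: algebra_simps)
    have "(x - c) \<bullet> (x - c) = R\<^sup>2" "(x' - c) \<bullet> (x' - c) = R\<^sup>2"
      using that(1,2) by (auto simp: C dist_norm norm_minus_commute dot_square_norm)
    then have "t * ((x' - c) \<bullet> e1 + (x - c) \<bullet> e1) = 0"
      unfolding x by (simp add: inner_add_left inner_add_right inner_commute algebra_simps)
    then have "t = 0" using pos by simp
    then show ?thesis using x by simp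
  qed
  obtain \<delta> where \<delta>: "\<delta> > 0" "\<And>s. \<bar>s - s0\<bar> < \<delta> \<Longrightarrow> s \<in> I \<and> (\<psi> s - c) \<bullet> e1 > 0"
  proof -
    have "isCont (\<lambda>s. (\<psi> s - c) \<bullet> e1) s0"
      using has_vector_derivative_continuous[OF \<psi>[OF s0]] by (intro continuous_intros)
    then have "((\<lambda>s. (\<psi> s - c) \<bullet> e1) \<longlongrightarrow> (\<psi> s0 - c) \<bullet> e1) (nhds s0)"
      using tendsto_at_iff_tendsto_nhds[of "\<lambda>s. (\<psi> s - c) \<bullet> e1" s0] by (simp add: isCont_def)
    then have "\<forall>\<^sub>F s in nhds s0. (\<psi> s - c) \<bullet> e1 > 0"
      by (rule order_tendstoD) (use e1R R in \<open>simp add: e1_def\<close>)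
    then have "\<forall>\<^sub>F s in nhds s0. s \<in> I \<and> (\<psi> s - c) \<bullet> e1 > 0"
      using eventually_nhds_in_open[OF I s0] by eventually_elim simp
    then show ?thesis
      using that unfolding eventually_nhds_metric dist_real_def by blast
  qed
  define h where "h s = (\<psi> s - c) \<bullet> e2" for s
  have "(h has_real_derivative e2 \<bullet> e2) (at s0)"
    using has_real_derivative_inner[OF has_vector_derivative_diff[OF \<psi>[OF s0] has_vector_derivative_const], of e2 c]
    by (simp add: h_def[abs_def] e2_def inner_commute)
  moreover have "e2 \<bullet> e2 > 0" using nonzero by simp
  ultimately obtain d1 d2 where d1: "d1 > 0" "\<And>t. t > 0 \<Longrightarrow> t < d1 \<Longrightarrow> h s0 < h (s0 + t)"
    and d2: "d2 > 0" "\<And>t. t > 0 \<Longrightarrow> t < d2 \<Longrightarrow> h (s0 - t) < h s0"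
    using DERIV_pos_inc_right[of h] DERIV_pos_inc_left[of h] by metis
  define t where "t = min \<delta> (min d1 d2) / 2"
  have t: "t > 0" "t < \<delta>" "t < d1" "t < d2"
    using \<delta> d1 d2 by (auto simp: t_def)
  define U where "U = {x. (x - c) \<bullet> e1 > 0} \<inter> {x. h (s0 - t) < (x - c) \<bullet> e2} \<inter> {x. (x - c) \<bullet> e2 < h (s0 + t)}"
  have "open U"
    unfolding U_def by (intro open_Int open_Collect_less continuous_intros)
  then have "openin (top_of_set C) (C \<inter> U)" by blast
  moreover have "y \<in> C \<inter> U"
    using \<delta>(2)[of s0] d1(2)[of t] d2(2)[of t] t \<delta>(1) sub s0 by (auto simp: y U_def h_def)
  moreover have "C \<inter> U \<subseteq> \<psi> ` I"
  proof
    fix x assume x: "x \<in> C \<inter> U"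
    have "continuous_on {s0 - t..s0 + t} h"
      unfolding h_def
      by (intro continuous_intros continuous_at_imp_continuous_on ballI
          has_vector_derivative_continuous[OF \<psi>]) (use \<delta>(2) t in auto)
    then obtain s where s: "s0 - t \<le> s" "s \<le> s0 + t" "h s = (x - c) \<bullet> e2"
      using IVT'[of h "s0 - t" "(x - c) \<bullet> e2" "s0 + t"] x t by (auto simp: U_def)
    then have "s \<in> I" "(\<psi> s - c) \<bullet> e1 > 0"
      using \<delta>(2)[of s] t by auto
    moreover from this have "\<psi> s = x"
      by (intro unique) (use s x sub in \<open>auto simp: U_def h_def\<close>)
    ultimately show "x \<in> \<psi> ` I" by blast
  qed
  ultimately show "\<exists>T. openin (top_of_set C) T \<and> y \<in> T \<and> T \<subseteq> \<psi> ` I" by blast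
qed

text \<open>If c had a component v in the plane of the circle, the opposite points c + e and c - e
  with e parallel to v would have different norms. With c on the axis, the relation of the radii is
  Pythagoras.\<close>

lemma circle_in_sphere_center:
  assumes C: "C = {x. n \<bullet> (x - c) = 0 \<and> dist c x = R}" and n: "norm n = 1" and R: "R > 0"
    and sub: "C \<subseteq> sphere 0 \<rho>" and x: "x \<in> C"
  shows "c = (n \<bullet> c) *\<^sub>R n" "\<rho>\<^sup>2 = R\<^sup>2 + (n \<bullet> c)\<^sup>2"
proof -
  have nn: "n \<bullet> n = 1" using n by (simp add: dot_square_norm)
  show c: "c = (n \<bullet> c) *\<^sub>R n"
  proof (rule ccontr)
    define v where "v = c - (n \<bullet> c) *\<^sub>R n"
    assume "c \<noteq> (n \<bullet> c) *\<^sub>R n"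
    then have v: "v \<noteq> 0" by (simp add: v_def)
    have nv: "n \<bullet> v = 0" by (simp add: v_def inner_diff_right nn)
    have cv: "c \<bullet> v = v \<bullet> v"
      using nv by (simp add: v_def inner_diff_left[of _ _ "c - (n \<bullet> c) *\<^sub>R n"])
    define e where "e = (R / norm v) *\<^sub>R v"
    have "c + e \<in> C" "c - e \<in> C"
      using nv v R by (auto simp: C e_def dist_norm)
    then have "norm (c + e) = \<rho>" "norm (c - e) = \<rho>"
      using sub by auto
    then have "(c + e) \<bullet> (c + e) = (c - e) \<bullet> (c - e)"
      by (simp add: dot_square_norm)
    then have "c \<bullet> e = 0"
      by (simp add: inner_add_left inner_add_right inner_diff_left inner_diff_right inner_commute)
    then show False using v R by (simp add: e_def cv)
  qed
  have "x \<bullet> x = \<rho>\<^sup>2" using sub x by (auto simp: dot_square_norm)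
  moreover have xc: "(x - c) \<bullet> (x - c) = R\<^sup>2" "n \<bullet> (x - c) = 0"
    using x by (auto simp: C dist_norm norm_minus_commute dot_square_norm)
  moreover have "c \<bullet> (x - c) = 0"
    by (subst c) (simp add: xc)
  then have "x \<bullet> x = (x - c) \<bullet> (x - c) + c \<bullet> c"
    by (simp add: inner_diff_left inner_diff_right inner_commute)
  moreover have "c \<bullet> c = (n \<bullet> c)\<^sup>2"
    by (subst (1 2) c) (simp add: nn power2_eq_square)
  ultimately show "\<rho>\<^sup>2 = R\<^sup>2 + (n \<bullet> c)\<^sup>2" by simp
qed

section \<open>Stereographic projection\<close>

text \<open>\<open>stereo_push m q u v\<close> is the image of \<open>u E\<^sub>1 + v E\<^sub>2\<close> under the differential of
  \<^const>\<open>inv_stereographic\<close>.\<close>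

definition stereo_push :: "real \<Rightarrow> real ^ 2 \<Rightarrow> real \<Rightarrow> real \<Rightarrow> real ^ 3" where
  "stereo_push m q u v = (let x = q $ 1; y = q $ 2; D = 1 + m * (x\<^sup>2 + y\<^sup>2) in
     vector [(u * (D - 2 * m * x\<^sup>2) - 2 * m * x * y * v) / D,
       (v * (D - 2 * m * y\<^sup>2) - 2 * m * x * y * u) / D,
       2 * sqrt m * (x * u + y * v) / D])"

context
  fixes m :: real
  assumes m: "m > 0"
begin

lemma stereographic_denominator_pos: "1 + m * ((q $ 1)\<^sup>2 + (q $ 2)\<^sup>2) > 0" for q :: "real ^ 2"
  using m by (simp add: add_pos_nonneg)

lemma stereo_push_inner: "stereo_push m q u v \<bullet> stereo_push m q u' v' = u * u' + v * v'"
proof -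
  define x y where "x = q $ 1" and "y = q $ 2"
  define D where "D = 1 + m * (x\<^sup>2 + y\<^sup>2)"
  have D: "D > 0" unfolding D_def x_def y_def by (rule stereographic_denominator_pos)
  have "stereo_push m q u v \<bullet> stereo_push m q u' v' = ((u * (D - 2 * m * x\<^sup>2) - 2 * m * x * y * v) *
      (u' * (D - 2 * m * x\<^sup>2) - 2 * m * x * y * v') +
      (v * (D - 2 * m * y\<^sup>2) - 2 * m * x * y * u) * (v' * (D - 2 * m * y\<^sup>2) - 2 * m * x * y * u')
      + 4 * m * (x * u + y * v) * (x * u' + y * v')) / D\<^sup>2"
    using D m unfolding stereo_push_def Let_def x_def[symmetric] y_def[symmetric] D_def[symmetric]
    by (simp add: inner_vec_def sum_3 power2_eq_square add_divide_distrib)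
  also have "\<dots> = D\<^sup>2 * (u * u' + v * v') / D\<^sup>2"
    unfolding D_def by (rule arg_cong[of _ _ "\<lambda>x. x / _"]) algebra
  finally show ?thesis using D by simp
qed

lemma inv_stereographic_inner_push: "inv_stereographic m q \<bullet> stereo_push m q u v = 0"
proof -
  define x y where "x = q $ 1" and "y = q $ 2"
  define D where "D = 1 + m * (x\<^sup>2 + y\<^sup>2)"
  have D: "D > 0" unfolding D_def x_def y_def by (rule stereographic_denominator_pos)
  have "inv_stereographic m q \<bullet> stereo_push m q u v =
    (x * (u * (D - 2 * m * x\<^sup>2) - 2 * m * x * y * v) + y * (v * (D - 2 * m * y\<^sup>2) - 2 * m * x * y * u)
     + (m * (x\<^sup>2 + y\<^sup>2) - 1) * (x * u + y * v)) / D\<^sup>2"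
    using D m unfolding inv_stereographic_def stereo_push_def Let_def x_def[symmetric] y_def[symmetric] D_def[symmetric]
    by (simp add: inner_vec_def sum_3 power2_eq_square add_divide_distrib)
  also have "\<dots> = 0 / D\<^sup>2"
    unfolding D_def by (rule arg_cong[of _ _ "\<lambda>x. x / _"]) algebra
  finally show ?thesis by simp
qed

lemma inv_stereographic_inner_self: "inv_stereographic m q \<bullet> inv_stereographic m q = 1 / (4 * m)"
proof -
  define x y where "x = q $ 1" and "y = q $ 2"
  define D where "D = 1 + m * (x\<^sup>2 + y\<^sup>2)"
  have D: "D > 0" unfolding D_def x_def y_def by (rule stereographic_denominator_pos)
  have "inv_stereographic m q \<bullet> inv_stereographic m q =
    (4 * m * (x\<^sup>2 + y\<^sup>2) + (m * (x\<^sup>2 + y\<^sup>2) - 1)\<^sup>2) / (4 * m * D\<^sup>2)"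
    using D m unfolding inv_stereographic_def Let_def x_def[symmetric] y_def[symmetric] D_def[symmetric]
    by (simp add: inner_vec_def sum_3 power2_eq_square add_divide_distrib)
  also have "\<dots> = D\<^sup>2 / (4 * m * D\<^sup>2)"
    unfolding D_def by (rule arg_cong[of _ _ "\<lambda>x. x / _"]) algebra
  finally show ?thesis using D by simp
qed

text \<open>The height of the image is (1 - 2 / D) / (2 sqrt m) and so recovers D; the other
  coordinates are those of the point divided by D.\<close>

lemma inj_inv_stereographic: "inj (inv_stereographic m)"
proof (rule injI)
  fix p q assume eq: "inv_stereographic m p = inv_stereographic m q"
  define D where "D q = 1 + m * ((q $ 1)\<^sup>2 + (q $ 2)\<^sup>2)" for q :: "real ^ 2"
  have D: "D q > 0" for q unfolding D_def by (rule stereographic_denominator_pos)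
  have third: "inv_stereographic m q $ 3 = (1 - 2 / D q) / (2 * sqrt m)" for q
  proof -
    have "m * ((q $ 1)\<^sup>2 + (q $ 2)\<^sup>2) = D q - 1" by (simp add: D_def)
    then show ?thesis
      using D[of q] m by (simp add: inv_stereographic_def Let_def) (simp add: field_simps)
  qed
  have "D p = D q"
    using arg_cong[OF eq, of "\<lambda>x. x $ 3"] m D[of p] D[of q] unfolding third by (simp add: field_simps)
  moreover have "inv_stereographic m q $ 1 = q $ 1 / D q" "inv_stereographic m q $ 2 = q $ 2 / D q" for q
    by (simp_all add: inv_stereographic_def Let_def D_def)
  ultimately show "p = q"
    using arg_cong[OF eq, of "\<lambda>x. x $ 1"] arg_cong[OF eq, of "\<lambda>x. x $ 2"] D[of q]
    by (simp add: vec_eq_iff forall_2 forall_3)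
qed

lemma continuous_inv_stereographic: "continuous_on UNIV (inv_stereographic m)"
proof -
  have "continuous_on UNIV (\<lambda>q. inv_stereographic m q $ i)" for i
  proof -
    have "\<forall>i. continuous_on UNIV (\<lambda>q. inv_stereographic m q $ i)"
      using stereographic_denominator_pos m unfolding forall_3 inv_stereographic_def Let_def
      by (auto intro!: continuous_intros simp: less_imp_neq[THEN not_sym])
    then show ?thesis by blast
  qed
  then show ?thesis
    by (subst continuous_on_componentwise) (simp add: Basis_vec_def inner_axis image_iff)
qed

end

lemma has_vector_derivative_vec_iff:
  fixes f :: "real \<Rightarrow> real ^ 'n"
  shows "(f has_vector_derivative f') (at s) \<longleftrightarrow>
    (\<forall>i. ((\<lambda>t. f t $ i) has_real_derivative f' $ i) (at s))"
  by (simp add: has_vector_derivative_def has_derivative_vec_iff has_field_derivative_def mult_commute_abs)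

section \<open>Curvature of the curve seen in the sphere\<close>

context bcv_curve
begin

lemma has_vector_derivative_inv_stereographic:
  assumes m: "m > 0" and s: "s \<in> I"
  shows "((\<lambda>s. inv_stereographic m (\<alpha> s)) has_vector_derivative stereo_push m (\<alpha> s) (c s) (\<sigma> s)) (at s)"
proof -
  \<comment> \<open>With m = r * r no square root is left, and clearing denominators gives
    identities within reach of \<open>algebra\<close>.\<close>
  define r where "r = sqrt m"
  have r: "m = r * r" "r \<noteq> 0" "sqrt m = r" using m by (simp_all add: r_def)
  note D = stereographic_denominator_pos[OF m, of "\<alpha> s"]
  show ?thesis
    unfolding has_vector_derivative_vec_iff forall_3 inv_stereographic_def stereo_push_def Let_def r(3)
    using D r(2)
    by (auto intro!: derivative_eq_intros dx[OF s] dy[OF s] simp: divide_simps)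
      (auto simp: r(1); algebra)+
qed

text \<open>The Gauss formula of the sphere: the tangential part is the covariant derivative in the
  base, with connection form 2 m (y c - x \<sigma>), and the factor 4 m of the normal part is the
  inverse square of the radius.\<close>

lemma has_vector_derivative_stereo_push:
  assumes m: "m > 0" and s: "s \<in> I"
    and u: "(u has_real_derivative u') (at s)" and v: "(v has_real_derivative v') (at s)"
  shows "((\<lambda>s. stereo_push m (\<alpha> s) (u s) (v s)) has_vector_derivative
    stereo_push m (\<alpha> s) (u' - 2 * m * (\<alpha> s $ 2 * c s - \<alpha> s $ 1 * \<sigma> s) * v s)
      (v' + 2 * m * (\<alpha> s $ 2 * c s - \<alpha> s $ 1 * \<sigma> s) * u s)
    - (4 * m * (u s * c s + v s * \<sigma> s)) *\<^sub>R inv_stereographic m (\<alpha> s)) (at s)"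
proof -
  define r where "r = sqrt m"
  have r: "m = r * r" "r \<noteq> 0" "sqrt m = r" using m by (simp_all add: r_def)
  note D = stereographic_denominator_pos[OF m, of "\<alpha> s"]
  show ?thesis
    unfolding has_vector_derivative_vec_iff forall_3 inv_stereographic_def stereo_push_def Let_def r(3)
    using D r(2)
    by (auto intro!: derivative_eq_intros dx[OF s] dy[OF s] u v simp: divide_simps)
      (auto simp: r(1); algebra)+
qed

end

context bcv_curve
begin

lemma stereographic_frenet:
  assumes m: "m > 0" and s: "s \<in> I"
  shows "((\<lambda>s. stereo_push m (\<alpha> s) (c s) (\<sigma> s)) has_vector_derivative
      \<kappa> s *\<^sub>R stereo_push m (\<alpha> s) (- \<sigma> s) (c s) - (4 * m) *\<^sub>R inv_stereographic m (\<alpha> s)) (at s)"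
    and "((\<lambda>s. stereo_push m (\<alpha> s) (- \<sigma> s) (c s)) has_vector_derivative
      - \<kappa> s *\<^sub>R stereo_push m (\<alpha> s) (c s) (\<sigma> s)) (at s)"
proof -
  have scale: "stereo_push m q (r * u) (r * v) = r *\<^sub>R stereo_push m q u v" for q r u v
    by (simp add: stereo_push_def Let_def vec_eq_iff forall_3 algebra_simps add_divide_distrib)
  have u: "c s * c s + \<sigma> s * \<sigma> s = 1"
    using unit[OF s] by (simp add: power2_eq_square)
  have "stereo_push m (\<alpha> s) (- \<sigma> s * (\<kappa> s - 2 * m * (\<alpha> s $ 2 * c s - \<alpha> s $ 1 * \<sigma> s))
        - 2 * m * (\<alpha> s $ 2 * c s - \<alpha> s $ 1 * \<sigma> s) * \<sigma> s)
      (c s * (\<kappa> s - 2 * m * (\<alpha> s $ 2 * c s - \<alpha> s $ 1 * \<sigma> s))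
        + 2 * m * (\<alpha> s $ 2 * c s - \<alpha> s $ 1 * \<sigma> s) * c s)
    = \<kappa> s *\<^sub>R stereo_push m (\<alpha> s) (- \<sigma> s) (c s)"
    unfolding scale[symmetric] by (rule arg_cong2[of _ _ _ _ "stereo_push m (\<alpha> s)"]) (simp_all add: algebra_simps)
  then show "((\<lambda>s. stereo_push m (\<alpha> s) (c s) (\<sigma> s)) has_vector_derivative
      \<kappa> s *\<^sub>R stereo_push m (\<alpha> s) (- \<sigma> s) (c s) - (4 * m) *\<^sub>R inv_stereographic m (\<alpha> s)) (at s)"
    using has_vector_derivative_stereo_push[OF m s dc[OF s] d\<sigma>[OF s]] u by simp
  have "stereo_push m (\<alpha> s) (- (c s * (\<kappa> s - 2 * m * (\<alpha> s $ 2 * c s - \<alpha> s $ 1 * \<sigma> s)))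
        - 2 * m * (\<alpha> s $ 2 * c s - \<alpha> s $ 1 * \<sigma> s) * c s)
      (- \<sigma> s * (\<kappa> s - 2 * m * (\<alpha> s $ 2 * c s - \<alpha> s $ 1 * \<sigma> s))
        + 2 * m * (\<alpha> s $ 2 * c s - \<alpha> s $ 1 * \<sigma> s) * - \<sigma> s)
    = (- \<kappa> s) *\<^sub>R stereo_push m (\<alpha> s) (c s) (\<sigma> s)"
    unfolding scale[symmetric] by (rule arg_cong2[of _ _ _ _ "stereo_push m (\<alpha> s)"]) (simp_all add: algebra_simps)
  then show "((\<lambda>s. stereo_push m (\<alpha> s) (- \<sigma> s) (c s)) has_vector_derivative
      - \<kappa> s *\<^sub>R stereo_push m (\<alpha> s) (c s) (\<sigma> s)) (at s)"
    using has_vector_derivative_stereo_push[OF m s DERIV_minus[OF d\<sigma>[OF s]] dc[OF s]] by simp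
qed

text \<open>If \<open>\<kappa>\<close> is constant then so is the vector \<open>N + \<kappa> \<psi>\<close>; it is normal to the plane of the circle.\<close>

lemma circle_if_constant_curvature:
  assumes m: "m > 0" and I: "is_interval I" "I \<noteq> {}" and k: "\<And>s. s \<in> I \<Longrightarrow> \<kappa> s = k"
  shows "\<exists>C. circle_in_sphere (1 / (2 * sqrt m)) (1 / sqrt (4 * m + k\<^sup>2)) C \<and>
    openin (top_of_set C) ((\<lambda>s. inv_stereographic m (\<alpha> s)) ` I)"
proof -
  define \<psi> where "\<psi> s = inv_stereographic m (\<alpha> s)" for s
  define T where "T s = stereo_push m (\<alpha> s) (c s) (\<sigma> s)" for s
  define N where "N s = stereo_push m (\<alpha> s) (- \<sigma> s) (c s)" for s
  define R where "R = 1 / sqrt (4 * m + k\<^sup>2)"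
  define S where "S = 4 * m + k\<^sup>2"
  have S: "S > 0" using m by (simp add: S_def add_pos_nonneg)
  have R: "R > 0" "R\<^sup>2 = 1 / S"
    using S by (simp_all add: R_def S_def power_divide)
  have d\<psi>: "(\<psi> has_vector_derivative T s) (at s)" if "s \<in> I" for s
    unfolding \<psi>_def[abs_def] T_def by (rule has_vector_derivative_inv_stereographic[OF m that])
  have "((\<lambda>s. N s + k *\<^sub>R \<psi> s) has_derivative (\<lambda>_. 0)) (at s within I)" if s: "s \<in> I" for s
  proof -
    have "((\<lambda>s. N s + k *\<^sub>R \<psi> s) has_vector_derivative - k *\<^sub>R T s + k *\<^sub>R T s) (at s)"
      using stereographic_frenet(2)[OF m s] d\<psi>[OF s] unfolding N_def[abs_def] T_def[symmetric] k[OF s]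
      by (intro has_vector_derivative_add bounded_linear.has_vector_derivative[OF bounded_linear_scaleR_right])
    then show ?thesis
      by (simp add: has_vector_derivative_def has_derivative_at_withinI)
  qed
  from has_derivative_zero_constant[OF is_interval_convex[OF I(1)] this]
  obtain A where A: "\<And>s. s \<in> I \<Longrightarrow> N s + k *\<^sub>R \<psi> s = A"
    by blast
  have NN: "N s \<bullet> N s = 1" "\<psi> s \<bullet> N s = 0" "\<psi> s \<bullet> \<psi> s = 1 / (4 * m)" "T s \<bullet> T s = 1" if "s \<in> I" for s
    using unit[OF that]
    by (simp_all add: N_def T_def \<psi>_def stereo_push_inner m inv_stereographic_inner_push
        inv_stereographic_inner_self power2_eq_square add.commute)
  have A\<psi>: "A \<bullet> \<psi> s = k / (4 * m)" if "s \<in> I" for s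
    using NN[OF that] unfolding A[OF that, symmetric]
    by (simp add: inner_add_left inner_commute[of "N s" "\<psi> s"])
  obtain s0 where s0: "s0 \<in> I" using I(2) by blast
  have AA: "A \<bullet> A = S / (4 * m)"
    using NN[OF s0] m unfolding A[OF s0, symmetric] S_def
    by (simp add: inner_add_left inner_add_right inner_commute field_simps power2_eq_square)
  have A0: "A \<noteq> 0" using AA S m by auto
  define n where "n = (1 / norm A) *\<^sub>R A"
  \<comment> \<open>The point nearest to the origin in the plane A \<bullet> x = k / (4 m), because
    A \<bullet> A = S / (4 m). Its squared norm is 1 / (4 m) - 1 / S, which accounts for the
    radius.\<close>
  define c0 where "c0 = (k / S) *\<^sub>R A"
  have n: "norm n = 1" using A0 by (simp add: n_def)
  have Ac: "A \<bullet> c0 = k / (4 * m)" using S by (simp add: c0_def AA)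
  have cc: "c0 \<bullet> c0 = k\<^sup>2 / (4 * m * S)"
    using S m by (simp add: c0_def AA power2_eq_square)
  define C where "C = {x. n \<bullet> (x - c0) = 0 \<and> dist c0 x = R}"
  \<comment> \<open>The circle is the section of the sphere by that plane; this form gives both its
    inclusion in the sphere and the membership of \<psi>.\<close>
  have C_iff: "x \<in> C \<longleftrightarrow> A \<bullet> x = k / (4 * m) \<and> x \<bullet> x = 1 / (4 * m)" for x
  proof -
    have "dist c0 x = R \<longleftrightarrow> (x - c0) \<bullet> (x - c0) = R\<^sup>2"
      using R(1) by (simp add: dist_norm norm_minus_commute dot_square_norm)
    also have "(x - c0) \<bullet> (x - c0) = x \<bullet> x - 2 * (c0 \<bullet> x) + c0 \<bullet> c0"
      by (simp add: inner_diff_left inner_diff_right inner_commute)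
    also have "c0 \<bullet> x = (k / S) * (A \<bullet> x)" by (simp add: c0_def)
    finally have dist: "dist c0 x = R \<longleftrightarrow> x \<bullet> x - 2 * ((k / S) * (A \<bullet> x)) + c0 \<bullet> c0 = R\<^sup>2" .
    have "n \<bullet> (x - c0) = 0 \<longleftrightarrow> A \<bullet> x = k / (4 * m)"
    proof -
      have "n \<bullet> (x - c0) = (A \<bullet> x - k / (4 * m)) / norm A"
        by (simp add: n_def inner_diff_right Ac diff_divide_distrib)
      then show ?thesis using A0 by simp
    qed
    then have "x \<in> C \<longleftrightarrow> A \<bullet> x = k / (4 * m) \<and> x \<bullet> x - 2 * ((k / S) * (k / (4 * m))) + c0 \<bullet> c0 = R\<^sup>2"
      unfolding C_def mem_Collect_eq dist by metis
    also have "x \<bullet> x - 2 * ((k / S) * (k / (4 * m))) + c0 \<bullet> c0 = R\<^sup>2 \<longleftrightarrow> x \<bullet> x = 1 / (4 * m)"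
    proof -
      have "R\<^sup>2 + 2 * ((k / S) * (k / (4 * m))) - c0 \<bullet> c0 = (4 * m + k\<^sup>2) / (4 * m * S)"
        unfolding R(2) cc using S m by (simp add: field_simps power2_eq_square)
      also have "\<dots> = 1 / (4 * m)" using S m by (simp add: S_def[symmetric])
      finally show ?thesis by linarith
    qed
    finally show ?thesis .
  qed
  have "C \<subseteq> sphere 0 (1 / (2 * sqrt m))"
    using m by (auto simp: C_iff norm_eq_sqrt_inner real_sqrt_divide real_sqrt_mult)
  then have "circle_in_sphere (1 / (2 * sqrt m)) R C"
    unfolding circle_in_sphere_def using R(1) n C_def by blast
  moreover have "openin (top_of_set C) (\<psi> ` I)"
  proof (rule open_image_in_circle[OF C_def n R(1) open_I d\<psi>])
    show "T s \<noteq> 0" if "s \<in> I" for s using NN(4)[OF that] by auto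
    show "\<psi> ` I \<subseteq> C" using A\<psi> NN(3) by (auto simp: C_iff)
  qed
  ultimately show ?thesis unfolding R_def \<psi>_def by blast
qed

text \<open>Differentiating n \<bullet> \<psi> = d twice gives n \<bullet> T = 0 and \<kappa> (n
  \<bullet> N) = 4 m d. The length of n in the frame \<psi>, T, N fixes (n \<bullet> N)^2. Only the
  square of \<kappa> can result, as the orientation of the curve is free.\<close>

lemma curvature_if_in_circle:
  assumes m: "m > 0" and C: "circle_in_sphere (1 / (2 * sqrt m)) R C"
    and sub: "(\<lambda>s. inv_stereographic m (\<alpha> s)) ` I \<subseteq> C" and s: "s \<in> I"
  shows "(\<kappa> s)\<^sup>2 = 1 / R\<^sup>2 - 4 * m"
proof -
  define \<psi> where "\<psi> s = inv_stereographic m (\<alpha> s)" for s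
  define T where "T s = stereo_push m (\<alpha> s) (c s) (\<sigma> s)" for s
  define N where "N s = stereo_push m (\<alpha> s) (- \<sigma> s) (c s)" for s
  obtain c n where n: "norm n = 1" and Ceq: "C = {x. n \<bullet> (x - c) = 0 \<and> dist c x = R}"
    and R: "R > 0" and sph: "C \<subseteq> sphere 0 (1 / (2 * sqrt m))"
    using C unfolding circle_in_sphere_def by blast
  define d where "d = n \<bullet> c"
  have in_C: "\<psi> t \<in> C" if "t \<in> I" for t using sub that by (auto simp: \<psi>_def)
  have d: "1 / (4 * m) = R\<^sup>2 + d\<^sup>2"
    using circle_in_sphere_center(2)[OF Ceq n R sph in_C[OF s]] m
    by (simp add: d_def power_divide)
  have n\<psi>: "n \<bullet> \<psi> t = d" if "t \<in> I" for t
    using in_C[OF that] by (simp add: Ceq inner_diff_right d_def)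
  have nT: "n \<bullet> T t = 0" if t: "t \<in> I" for t
    using has_real_derivative_inner[OF has_vector_derivative_inv_stereographic[OF m t]] n\<psi>
    unfolding T_def \<psi>_def by (intro constant_imp_derivative_0[OF _ open_I t])
  have "n \<bullet> (\<kappa> s *\<^sub>R N s - (4 * m) *\<^sub>R \<psi> s) = 0"
    using has_real_derivative_inner[OF stereographic_frenet(1)[OF m s]] nT
    unfolding T_def N_def \<psi>_def by (intro constant_imp_derivative_0[OF _ open_I s])
  then have \<kappa>N: "\<kappa> s * (n \<bullet> N s) = 4 * m * d"
    using n\<psi>[OF s] by (simp add: inner_diff_right)
  have orth: "N s \<bullet> N s = 1" "\<psi> s \<bullet> N s = 0" "\<psi> s \<bullet> \<psi> s = 1 / (4 * m)" "T s \<bullet> T s = 1"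
      "\<psi> s \<bullet> T s = 0" "T s \<bullet> N s = 0"
    using unit[OF s]
    by (simp_all add: N_def T_def \<psi>_def stereo_push_inner m inv_stereographic_inner_push
        inv_stereographic_inner_self power2_eq_square add.commute)
  have sym: "N s \<bullet> \<psi> s = 0" "N s \<bullet> T s = 0" "T s \<bullet> \<psi> s = 0"
    using orth by (simp_all add: inner_commute)
  \<comment> \<open>The difference of n and its expansion; the coefficient of \<psi> is 4 m d
    because \<psi> has squared norm 1 / (4 m).\<close>
  define z where "z = n - (n \<bullet> N s) *\<^sub>R N s - (4 * m * d) *\<^sub>R \<psi> s"
  have "z = 0"
  proof (rule orthogonal_frame_3)
    show "\<psi> s \<noteq> 0" "T s \<noteq> 0" "N s \<noteq> 0" using orth m by auto
    show "\<psi> s \<bullet> T s = 0" "\<psi> s \<bullet> N s = 0" "T s \<bullet> N s = 0" by (fact orth)+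
    show "z \<bullet> \<psi> s = 0" "z \<bullet> T s = 0" "z \<bullet> N s = 0"
      using orth sym m nT[OF s] n\<psi>[OF s] by (simp_all add: z_def inner_diff_left)
  qed
  then have "n = (n \<bullet> N s) *\<^sub>R N s + (4 * m * d) *\<^sub>R \<psi> s"
    by (simp add: z_def algebra_simps)
  then have "n \<bullet> n = n \<bullet> ((n \<bullet> N s) *\<^sub>R N s + (4 * m * d) *\<^sub>R \<psi> s)"
    by simp
  then have "(n \<bullet> N s)\<^sup>2 = 1 - 4 * m * d\<^sup>2"
    using n n\<psi>[OF s] by (simp add: dot_square_norm inner_add_right power2_eq_square)
  also have "\<dots> = 4 * m * R\<^sup>2"
    using d m by (simp add: field_simps)
  finally have "(\<kappa> s)\<^sup>2 * (4 * m * R\<^sup>2) = (4 * m * d)\<^sup>2"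
    using \<kappa>N by (metis power_mult_distrib)
  also have "\<dots> = 4 * m * (1 - 4 * m * R\<^sup>2)"
  proof -
    have "1 - 4 * m * R\<^sup>2 = 4 * m * d\<^sup>2"
      using d m by (simp add: field_simps)
    then show ?thesis by (simp add: power2_eq_square)
  qed
  finally have "(\<kappa> s)\<^sup>2 * R\<^sup>2 = 1 - 4 * m * R\<^sup>2"
    using m by (simp add: mult_ac)
  then show ?thesis using R by (simp add: field_simps)
qed

section \<open>The biharmonic equation as a condition on the curvature\<close>

lemma zero_derivative_imp_constant:
  assumes "is_interval I" "\<And>s. s \<in> I \<Longrightarrow> (f has_real_derivative 0) (at s)" "s \<in> I" "t \<in> I"
  shows "f s = f t"
proof -
  have "\<exists>k. \<forall>s\<in>I. f s = k"
    using assms(1,2) by (intro has_field_derivative_zero_constant)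
      (auto intro: is_interval_convex has_field_derivative_at_within)
  then show ?thesis using assms(3,4) by auto
qed

text \<open>Pointwise, \<kappa> \<kappa>' = 0 leaves a choice at each s. Read as (\<kappa>^2)' = 0
  on an interval, it carries the nonvanishing of \<kappa> from one point to all of I, so \<kappa>' =
  0 throughout and the normal equation becomes algebraic.\<close>

lemma proper_biharmonic_iff_curvature:
  assumes I: "is_interval I" "I \<noteq> {}"
  shows "proper_biharmonic_surface (hopf_domain I) (bcv_metric m l) (hopf_immersion \<alpha>) \<longleftrightarrow>
    4 * m - l\<^sup>2 > 0 \<and> (\<exists>k. \<forall>s\<in>I. \<kappa> s = k \<and> k\<^sup>2 = 4 * m - l\<^sup>2)"
    (is "?P \<longleftrightarrow> ?Q")
proof
  assume ?P
  then obtain s0 where s0: "s0 \<in> I" "\<kappa> s0 \<noteq> 0"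
    and bi: "\<And>s. s \<in> I \<Longrightarrow> \<kappa> s * \<kappa>1 s = 0"
      "\<And>s. s \<in> I \<Longrightarrow> \<kappa>2 s - (\<kappa> s) ^ 3 + \<kappa> s * (4 * m - l\<^sup>2) = 0"
    unfolding proper_biharmonic_iff by blast
  have "((\<lambda>s. (\<kappa> s)\<^sup>2) has_real_derivative 0) (at s)" if s: "s \<in> I" for s
    using bi(1)[OF s] by (auto intro!: derivative_eq_intros d\<kappa> s)
  then have "(\<kappa> s)\<^sup>2 = (\<kappa> s0)\<^sup>2" if "s \<in> I" for s
    using zero_derivative_imp_constant[OF I(1), of "\<lambda>s. (\<kappa> s)\<^sup>2"] that s0(1) by blast
  then have \<kappa>1: "\<kappa>1 s = 0" if "s \<in> I" for s
    using bi(1)[OF that] s0(2) that by force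
  have \<kappa>2: "\<kappa>2 s0 = 0"
    by (rule constant_imp_derivative_0[OF d\<kappa>1 open_I _ \<kappa>1]) (use s0 in auto)
  have "\<kappa> s = \<kappa> s0" if "s \<in> I" for s
    using zero_derivative_imp_constant[OF I(1), of \<kappa>] d\<kappa> \<kappa>1 that s0(1) by metis
  moreover have "\<kappa> s0 * ((\<kappa> s0)\<^sup>2 - (4 * m - l\<^sup>2)) = 0"
    using bi(2)[OF s0(1)] unfolding \<kappa>2 by (simp add: power3_eq_cube power2_eq_square algebra_simps)
  then have "(\<kappa> s0)\<^sup>2 = 4 * m - l\<^sup>2" using s0(2) by simp
  moreover from this have "4 * m - l\<^sup>2 > 0"
    using s0(2) by (metis zero_less_power2)
  ultimately show ?Q by blast
next
  assume ?Q
  then obtain k where k: "\<And>s. s \<in> I \<Longrightarrow> \<kappa> s = k" and k2: "k\<^sup>2 = 4 * m - l\<^sup>2" "4 * m - l\<^sup>2 > 0"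
    using I(2) by blast
  have \<kappa>1: "\<kappa>1 s = 0" if "s \<in> I" for s
    by (rule constant_imp_derivative_0[OF d\<kappa> open_I _ k]) (use that in auto)
  have \<kappa>2: "\<kappa>2 s = 0" if "s \<in> I" for s
    by (rule constant_imp_derivative_0[OF d\<kappa>1 open_I _ \<kappa>1]) (use that in auto)
  have "k \<noteq> 0" using k2 by auto
  moreover have "k ^ 3 = k * (4 * m - l\<^sup>2)"
    unfolding k2(1)[symmetric] by (simp add: power3_eq_cube power2_eq_square)
  ultimately show ?P
    unfolding proper_biharmonic_iff using I(2) by (auto simp: k \<kappa>1 \<kappa>2)
qed

lemma circle_if_proper_biharmonic:
  assumes I: "is_interval I" "I \<noteq> {}"
    and P: "proper_biharmonic_surface (hopf_domain I) (bcv_metric m l) (hopf_immersion \<alpha>)"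
  shows "m > 0" "4 * m - l\<^sup>2 > 0"
    "\<exists>C. circle_in_sphere (1 / (2 * sqrt m)) (1 / sqrt (8 * m - l\<^sup>2)) C \<and>
      openin (top_of_set C) ((\<lambda>s. inv_stereographic m (\<alpha> s)) ` I)"
proof -
  obtain k where pos: "4 * m - l\<^sup>2 > 0" and k: "\<And>s. s \<in> I \<Longrightarrow> \<kappa> s = k" "k\<^sup>2 = 4 * m - l\<^sup>2"
    using P unfolding proper_biharmonic_iff_curvature[OF I] using I(2) by blast
  show "4 * m - l\<^sup>2 > 0" by fact
  show m: "m > 0" using pos zero_le_power2[of l] by linarith
  have eq: "8 * m - l\<^sup>2 = 4 * m + k\<^sup>2" using k(2) by simp
  show "\<exists>C. circle_in_sphere (1 / (2 * sqrt m)) (1 / sqrt (8 * m - l\<^sup>2)) C \<and>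
      openin (top_of_set C) ((\<lambda>s. inv_stereographic m (\<alpha> s)) ` I)"
    unfolding eq by (rule circle_if_constant_curvature[OF m I k(1)])
qed

text \<open>The circle determines \<kappa>^2, a positive constant. Differentiating the square gives
  \<kappa>' = 0, so \<kappa> cannot change sign.\<close>

lemma proper_biharmonic_if_in_circle:
  assumes I: "is_interval I" "I \<noteq> {}" and m: "m > 0" and pos: "4 * m - l\<^sup>2 > 0"
    and C: "circle_in_sphere (1 / (2 * sqrt m)) (1 / sqrt (8 * m - l\<^sup>2)) C"
    and sub: "(\<lambda>s. inv_stereographic m (\<alpha> s)) ` I \<subseteq> C"
  shows "proper_biharmonic_surface (hopf_domain I) (bcv_metric m l) (hopf_immersion \<alpha>)"
proof -
  have \<kappa>sq: "(\<kappa> s)\<^sup>2 = 4 * m - l\<^sup>2" if "s \<in> I" for s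
    using curvature_if_in_circle[OF m C sub that] m pos by (simp add: power_divide)
  have "\<kappa>1 s = 0" if s: "s \<in> I" for s
  proof -
    have "((\<lambda>s. (\<kappa> s)\<^sup>2) has_real_derivative 2 * \<kappa> s * \<kappa>1 s) (at s)"
      by (auto intro!: derivative_eq_intros d\<kappa> s)
    then have "2 * \<kappa> s * \<kappa>1 s = 0"
      by (rule constant_imp_derivative_0[OF _ open_I s \<kappa>sq])
    then show ?thesis using \<kappa>sq[OF s] pos by auto
  qed
  then have "(\<kappa> has_real_derivative 0) (at s)" if "s \<in> I" for s
    using d\<kappa>[OF that] that by simp
  note const = zero_derivative_imp_constant[OF I(1) this]
  obtain s0 where "s0 \<in> I" using I(2) by blast
  then have "\<forall>s\<in>I. \<kappa> s = \<kappa> s0 \<and> (\<kappa> s0)\<^sup>2 = 4 * m - l\<^sup>2"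
    using const \<kappa>sq by blast
  then show ?thesis
    unfolding proper_biharmonic_iff_curvature[OF I] using pos by blast
qed

end

section \<open>Frenet data of a smooth unit speed curve\<close>

lemma bcv_curve_exists:
  assumes "open I" and base: "\<alpha> ` I \<subseteq> base_space m" and smooth: "smooth_curve_on I \<alpha>"
    and unit: "unit_speed_on I (base_metric m) \<alpha>"
  shows "\<exists>c \<sigma> \<kappa> \<kappa>1 \<kappa>2. bcv_curve m I \<alpha> c \<sigma> \<kappa> \<kappa>1 \<kappa>2"
proof -
  define a where "a k = ((\<lambda>\<beta> t. vector_derivative \<beta> (at t)) ^^ k) \<alpha>" for k
  have da: "((\<lambda>s. a k s $ i) has_real_derivative a (Suc k) s $ i) (at s)" if "s \<in> I" for k s i
  proof -
    have "a k differentiable at s" using smooth that by (auto simp: smooth_curve_on_def a_def)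
    then have "(a k has_vector_derivative a (Suc k) s) (at s)"
      using vector_derivative_works by (fastforce simp: a_def)
    then show ?thesis by (simp add: has_vector_derivative_vec_iff)
  qed
  define x0 where "x0 s = \<alpha> s $ 1" for s
  define y0 where "y0 s = \<alpha> s $ 2" for s
  define x1 where "x1 s = a 1 s $ 1" for s
  define y1 where "y1 s = a 1 s $ 2" for s
  define x2 where "x2 s = a 2 s $ 1" for s
  define y2 where "y2 s = a 2 s $ 2" for s
  define x3 where "x3 s = a 3 s $ 1" for s
  define y3 where "y3 s = a 3 s $ 2" for s
  have a0: "a 0 = \<alpha>" by (simp add: a_def)
  have dxy: "(x0 has_real_derivative x1 s) (at s)" "(y0 has_real_derivative y1 s) (at s)"
      "(x1 has_real_derivative x2 s) (at s)" "(y1 has_real_derivative y2 s) (at s)"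
      "(x2 has_real_derivative x3 s) (at s)" "(y2 has_real_derivative y3 s) (at s)"
      "x3 field_differentiable at s" "y3 field_differentiable at s"
    if "s \<in> I" for s
    using da[OF that, of 0] da[OF that, of 1] da[OF that, of 2] da[OF that, of 3]
    unfolding x0_def[abs_def] y0_def[abs_def] x1_def[abs_def] y1_def[abs_def] x2_def[abs_def]
      y2_def[abs_def] x3_def[abs_def] y3_def[abs_def] a0
    by (simp_all add: numeral_2_eq_2 numeral_3_eq_3 field_differentiable_def) blast+
  define D where "D s = 1 + m * ((x0 s)\<^sup>2 + (y0 s)\<^sup>2)" for s
  define D1 where "D1 s = 2 * m * (x0 s * x1 s + y0 s * y1 s)" for s
  have D: "D s > 0" if "s \<in> I" for s
    using base that by (auto simp: base_space_def D_def x0_def y0_def)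
  have dD: "(D has_real_derivative D1 s) (at s)" if "s \<in> I" for s
    unfolding D_def[abs_def] D1_def
    by (auto intro!: derivative_eq_intros dxy that simp: algebra_simps)
  have a1: "vector_derivative \<alpha> (at s) = a 1 s" for s by (simp add: a_def)
  have speed: "(x1 s)\<^sup>2 + (y1 s)\<^sup>2 = (D s)\<^sup>2" if "s \<in> I" for s
  proof -
    have "base_metric m (\<alpha> s) (a 1 s) (a 1 s) = ((x1 s)\<^sup>2 + (y1 s)\<^sup>2) / (D s)\<^sup>2"
      by (simp add: base_metric_def D_def x0_def y0_def x1_def y1_def power2_eq_square)
    then show ?thesis
      using unit D[OF that] that by (simp add: unit_speed_on_def a1)
  qed
  have accel: "x1 s * x2 s + y1 s * y2 s = D s * D1 s" if s: "s \<in> I" for s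
  proof -
    have "((\<lambda>s. (x1 s)\<^sup>2 + (y1 s)\<^sup>2 - (D s)\<^sup>2) has_real_derivative
        2 * (x1 s * x2 s + y1 s * y2 s - D s * D1 s)) (at s)"
      by (auto intro!: derivative_eq_intros dxy dD s simp: algebra_simps)
    from constant_imp_derivative_0[OF this \<open>open I\<close> s, of 0] speed show ?thesis by simp
  qed
  \<comment> \<open>The rotation speed of the velocity (x1, y1), whose squared Euclidean length is
    D^2 by unit speed. Adding the connection term of the conformal metric gives the geodesic
    curvature.\<close>
  define w where "w s = (x1 s * y2 s - y1 s * x2 s) / (D s)\<^sup>2" for s
  define \<kappa> where "\<kappa> s = w s + 2 * m * ((y0 s * x1 s - x0 s * y1 s) / D s)" for s
  have field_diff: "x0 field_differentiable at s" "y0 field_differentiable at s"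
      "x1 field_differentiable at s" "y1 field_differentiable at s"
      "x2 field_differentiable at s" "y2 field_differentiable at s" "D field_differentiable at s"
    if "s \<in> I" for s
    using dxy dD that field_differentiable_def by blast+
  define w1 where "w1 s = (x1 s * y3 s - y1 s * x3 s) / (D s)\<^sup>2
     - 2 * (x1 s * y2 s - y1 s * x2 s) * D1 s / (D s) ^ 3" for s
  define \<kappa>1 where "\<kappa>1 s = w1 s + 2 * m * ((y0 s * x2 s - x0 s * y2 s) / D s
    - (y0 s * x1 s - x0 s * y1 s) * D1 s / (D s)\<^sup>2)" for s
  have dw: "(w has_real_derivative w1 s) (at s)" if s: "s \<in> I" for s
  proof -
    have "((\<lambda>s. x1 s * y2 s - y1 s * x2 s) has_real_derivative x1 s * y3 s - y1 s * x3 s) (at s)"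
      by (auto intro!: derivative_eq_intros dxy s simp: algebra_simps)
    moreover have "(p * (D s)\<^sup>2 - n * (real 2 * (D1 s * D s ^ (2 - Suc 0)))) / ((D s)\<^sup>2 * (D s)\<^sup>2)
        = p / (D s)\<^sup>2 - 2 * n * D1 s / (D s) ^ 3" for p n
      using D[OF s] by (simp add: field_simps power2_eq_square power3_eq_cube)
    ultimately show ?thesis
      using DERIV_divide[OF _ DERIV_power[OF dD[OF s], of 2]] D[OF s]
      unfolding w_def[abs_def] w1_def by fastforce
  qed
  \<comment> \<open>The derivative of \<kappa> is explicit and involves three derivatives of
    \<alpha>; a fourth makes it differentiable, and its own derivative can be left as
    \<open>deriv\<close>.\<close>
  have "bcv_curve m I \<alpha> (\<lambda>s. x1 s / D s) (\<lambda>s. y1 s / D s) \<kappa> \<kappa>1 (deriv \<kappa>1)"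
  proof
    fix s assume s: "s \<in> I"
    note Ds = D[OF s]
    show "\<alpha> s \<in> base_space m" using base s by blast
    show "((\<lambda>s. \<alpha> s $ 1) has_real_derivative
        (1 + m * ((\<alpha> s $ 1)\<^sup>2 + (\<alpha> s $ 2)\<^sup>2)) * (x1 s / D s)) (at s)"
      using dxy(1)[OF s] Ds by (simp add: D_def[unfolded x0_def y0_def, symmetric] x0_def[abs_def])
    show "((\<lambda>s. \<alpha> s $ 2) has_real_derivative
        (1 + m * ((\<alpha> s $ 1)\<^sup>2 + (\<alpha> s $ 2)\<^sup>2)) * (y1 s / D s)) (at s)"
      using dxy(2)[OF s] Ds by (simp add: D_def[unfolded x0_def y0_def, symmetric] y0_def[abs_def])
    have \<kappa>w: "\<kappa> s - 2 * m * (\<alpha> s $ 2 * (x1 s / D s) - \<alpha> s $ 1 * (y1 s / D s)) = w s"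
      using Ds by (simp add: \<kappa>_def x0_def y0_def field_simps)
    \<comment> \<open>The numerator of the quotient rule, after D^2 is replaced by x1^2 + y1^2 and D
      D1 by x1 x2 + y1 y2.\<close>
    have "(x2 s * D s - x1 s * D1 s) * D s = - y1 s * (x1 s * y2 s - y1 s * x2 s)"
      using accel[OF s] speed[OF s] by algebra
    then have "(x2 s * D s - x1 s * D1 s) * D s / (D s * (D s)\<^sup>2) = - (y1 s / D s) * w s"
      by (simp add: w_def)
    then have "(x2 s * D s - x1 s * D1 s) / (D s * D s) = - (y1 s / D s) * w s"
      using Ds by (simp add: power2_eq_square)
    then show "((\<lambda>s. x1 s / D s) has_real_derivative
       - (y1 s / D s) * (\<kappa> s - 2 * m * (\<alpha> s $ 2 * (x1 s / D s) - \<alpha> s $ 1 * (y1 s / D s)))) (at s)"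
      unfolding \<kappa>w using DERIV_divide[OF dxy(3)[OF s] dD[OF s]] Ds by simp
    have "(y2 s * D s - y1 s * D1 s) * D s = x1 s * (x1 s * y2 s - y1 s * x2 s)"
      using accel[OF s] speed[OF s] by algebra
    then have "(y2 s * D s - y1 s * D1 s) * D s / (D s * (D s)\<^sup>2) = (x1 s / D s) * w s"
      by (simp add: w_def)
    then have "(y2 s * D s - y1 s * D1 s) / (D s * D s) = (x1 s / D s) * w s"
      using Ds by (simp add: power2_eq_square)
    then show "((\<lambda>s. y1 s / D s) has_real_derivative
       (x1 s / D s) * (\<kappa> s - 2 * m * (\<alpha> s $ 2 * (x1 s / D s) - \<alpha> s $ 1 * (y1 s / D s)))) (at s)"
      unfolding \<kappa>w using DERIV_divide[OF dxy(4)[OF s] dD[OF s]] Ds by simp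
    show "(x1 s / D s)\<^sup>2 + (y1 s / D s)\<^sup>2 = 1"
      using speed[OF s] Ds by (simp add: power_divide flip: add_divide_distrib)
    show "(\<kappa> has_real_derivative \<kappa>1 s) (at s)"
    proof -
      have "((\<lambda>s. y0 s * x1 s - x0 s * y1 s) has_real_derivative y0 s * x2 s - x0 s * y2 s) (at s)"
        by (auto intro!: derivative_eq_intros dxy s simp: algebra_simps)
      moreover have "D s \<noteq> 0" using Ds by simp
      ultimately have "((\<lambda>s. w s + 2 * m * ((y0 s * x1 s - x0 s * y1 s) / D s)) has_real_derivative
        w1 s + 2 * m * (((y0 s * x2 s - x0 s * y2 s) * D s - (y0 s * x1 s - x0 s * y1 s) * D1 s)
          / (D s * D s))) (at s)"
        by (intro DERIV_add dw DERIV_cmult DERIV_divide dD s)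
      then show ?thesis
        using Ds by (simp add: \<kappa>_def[abs_def] \<kappa>1_def diff_divide_distrib power2_eq_square)
    qed
    have "\<kappa>1 field_differentiable at s"
      using Ds unfolding \<kappa>1_def[abs_def] w1_def D1_def
      by (intro derivative_intros field_diff dxy(7,8) s) auto
    then show "(\<kappa>1 has_real_derivative deriv \<kappa>1 s) (at s)"
      by (simp add: DERIV_deriv_iff_field_differentiable)
  qed fact
  then show ?thesis by blast
qed

section \<open>From arcs of circles to pieces of cylinders\<close>

lemma product_identification_hopf_cylinder:
  assumes "B \<subseteq> base_space m"
  shows "product_identification m ` hopf_cylinder m B = inv_stereographic m ` B \<times> UNIV"
proof (intro equalityI subsetI)
  fix z assume "z \<in> inv_stereographic m ` B \<times> (UNIV :: real set)"
  then obtain q t where q: "q \<in> B" "z = (inv_stereographic m q, t)" by auto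
  define p :: "real ^ 3" where "p = vector [q $ 1, q $ 2, t]"
  have "bcv_proj p = q" by (simp add: bcv_proj_def p_def vec_eq_iff forall_2)
  moreover have "p \<in> bcv_space m"
    using assms q(1) by (auto simp: bcv_space_def base_space_def p_def)
  ultimately show "z \<in> product_identification m ` hopf_cylinder m B"
    using q by (intro image_eqI[of _ _ p]) (auto simp: product_identification_def hopf_cylinder_def p_def)
qed (auto simp: product_identification_def hopf_cylinder_def)

text \<open>An open set that cuts the image of B out of C pulls back along the continuous map to the
  sphere. Injectivity of the projection ensures that it cuts out the cylinder over B and nothing
  more.\<close>

lemma openin_hopf_cylinder:
  assumes m: "m > 0" and B: "B \<subseteq> base_space m" and op: "openin (top_of_set C) (inv_stereographic m ` B)"
  shows "openin (top_of_set (hopf_cylinder m {q \<in> base_space m. inv_stereographic m q \<in> C})) (hopf_cylinder m B)"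
proof -
  obtain T where T: "open T" "inv_stereographic m ` B = C \<inter> T"
    using op by (auto simp: openin_open)
  have "linear bcv_proj"
    by (intro linearI) (simp_all add: bcv_proj_def vec_eq_iff forall_2)
  then have "continuous_on UNIV bcv_proj"
    by (simp add: linear_continuous_on linear_conv_bounded_linear)
  then have "open ((\<lambda>p. inv_stereographic m (bcv_proj p)) -` T)"
    using T(1) by (intro open_vimage continuous_on_compose2[OF continuous_inv_stereographic[OF m]]) auto
  moreover have "hopf_cylinder m B = hopf_cylinder m {q \<in> base_space m. inv_stereographic m q \<in> C}
      \<inter> (\<lambda>p. inv_stereographic m (bcv_proj p)) -` T"
  proof -
    have "q \<in> B \<longleftrightarrow> q \<in> base_space m \<and> inv_stereographic m q \<in> C \<and> inv_stereographic m q \<in> T" for q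
      using T(2) B inj_image_mem_iff[OF inj_inv_stereographic[OF m], of q B] by blast
    then show ?thesis by (auto simp: hopf_cylinder_def)
  qed
  ultimately show ?thesis by (auto simp: openin_open)
qed

theorem theorem2p2:
  fixes m l :: real and I :: "real set" and \<alpha> :: "real \<Rightarrow> real ^ 2"
  assumes "is_interval I" and "open I" and "I \<noteq> {}"
    and "\<alpha> ` I \<subseteq> base_space m"
    and "smooth_curve_on I \<alpha>"
    and "unit_speed_on I (base_metric m) \<alpha>"
  shows "proper_biharmonic_surface (hopf_domain I) (bcv_metric m l) (hopf_immersion \<alpha>) \<longleftrightarrow>
    (m > 0 \<and> l = 0 \<and>
      (\<exists>C. circle_in_sphere (1 / (2 * sqrt m)) (1 / (2 * sqrt (2 * m))) C \<and>
        open_piece (product_identification m ` hopf_cylinder m (\<alpha> ` I)) (C \<times> UNIV))) \<or>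
    (m > 0 \<and> l \<noteq> 0 \<and> 4 * m - l\<^sup>2 > 0 \<and>
      (\<exists>C. circle_in_sphere (1 / (2 * sqrt m)) (1 / sqrt (8 * m - l\<^sup>2)) C \<and>
        open_piece (hopf_cylinder m (\<alpha> ` I))
          (hopf_cylinder m {q \<in> base_space m. inv_stereographic m q \<in> C})))"
proof -
  obtain c \<sigma> \<kappa> \<kappa>1 \<kappa>2 where "bcv_curve m I \<alpha> c \<sigma> \<kappa> \<kappa>1 \<kappa>2"
    using bcv_curve_exists[OF assms(2,4,5,6)] by blast
  then interpret bcv_curve m l I \<alpha> c \<sigma> \<kappa> \<kappa>1 \<kappa>2 .
  note I = assms(1,3)
  have R: "1 / (2 * sqrt (2 * m)) = 1 / sqrt (8 * m - l\<^sup>2)" if "l = 0"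
  proof -
    have "sqrt (8 * m) = sqrt (2\<^sup>2 * (2 * m))" by simp
    also have "\<dots> = 2 * sqrt (2 * m)" by (subst real_sqrt_mult) simp
    finally show ?thesis using that by simp
  qed
  have image: "(\<lambda>s. inv_stereographic m (\<alpha> s)) ` I = inv_stereographic m ` \<alpha> ` I"
    by (simp add: image_image)
  show ?thesis
  proof (intro iffI; (elim disjE conjE exE)?)
    assume P: "proper_biharmonic_surface (hopf_domain I) (bcv_metric m l) (hopf_immersion \<alpha>)"
    note m = circle_if_proper_biharmonic(1,2)[OF I P]
    obtain C where C: "circle_in_sphere (1 / (2 * sqrt m)) (1 / sqrt (8 * m - l\<^sup>2)) C"
      "openin (top_of_set C) (inv_stereographic m ` \<alpha> ` I)"
      using circle_if_proper_biharmonic(3)[OF I P] unfolding image by blast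
    have "openin (top_of_set (C \<times> UNIV)) (product_identification m ` hopf_cylinder m (\<alpha> ` I))"
      unfolding product_identification_hopf_cylinder[OF assms(4)]
      by (intro openin_Times C(2)) simp
    moreover note openin_hopf_cylinder[OF m(1) assms(4) C(2)]
    ultimately show "(m > 0 \<and> l = 0 \<and>
      (\<exists>C. circle_in_sphere (1 / (2 * sqrt m)) (1 / (2 * sqrt (2 * m))) C \<and>
        open_piece (product_identification m ` hopf_cylinder m (\<alpha> ` I)) (C \<times> UNIV))) \<or>
      (m > 0 \<and> l \<noteq> 0 \<and> 4 * m - l\<^sup>2 > 0 \<and>
      (\<exists>C. circle_in_sphere (1 / (2 * sqrt m)) (1 / sqrt (8 * m - l\<^sup>2)) C \<and>
        open_piece (hopf_cylinder m (\<alpha> ` I))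
          (hopf_cylinder m {q \<in> base_space m. inv_stereographic m q \<in> C})))"
      unfolding open_piece_def using m C(1) R by (cases "l = 0") auto
  next
    fix C assume m: "m > 0" and l: "l = 0"
      and C: "circle_in_sphere (1 / (2 * sqrt m)) (1 / (2 * sqrt (2 * m))) C"
      and "open_piece (product_identification m ` hopf_cylinder m (\<alpha> ` I)) (C \<times> UNIV)"
    then have "inv_stereographic m ` \<alpha> ` I \<subseteq> C"
      unfolding open_piece_def product_identification_hopf_cylinder[OF assms(4)]
      by (auto dest!: openin_imp_subset)
    then show "proper_biharmonic_surface (hopf_domain I) (bcv_metric m l) (hopf_immersion \<alpha>)"
      using proper_biharmonic_if_in_circle[OF I m _ C[unfolded R[OF l]]] m l unfolding image by simp
  next
    fix C assume m: "m > 0" and pos: "4 * m - l\<^sup>2 > 0"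
      and C: "circle_in_sphere (1 / (2 * sqrt m)) (1 / sqrt (8 * m - l\<^sup>2)) C"
      and "open_piece (hopf_cylinder m (\<alpha> ` I))
          (hopf_cylinder m {q \<in> base_space m. inv_stereographic m q \<in> C})"
    then have cyl: "hopf_cylinder m (\<alpha> ` I) \<subseteq> hopf_cylinder m {q \<in> base_space m. inv_stereographic m q \<in> C}"
      unfolding open_piece_def by (auto dest!: openin_imp_subset)
    have "inv_stereographic m (\<alpha> s) \<in> C" if s: "s \<in> I" for s
    proof -
      \<comment> \<open>One point on each fibre, here at height 0, suffices to bring the inclusion
        of cylinders down to the base.\<close>
      have "hopf_immersion \<alpha> (vector [s, 0]) \<in> hopf_cylinder m (\<alpha> ` I)"
        using s unfolding hopf_immersion_image[OF assms(4), symmetric]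
        by (intro imageI) (simp add: hopf_domain_def)
      moreover have "bcv_proj (hopf_immersion \<alpha> (vector [s, 0])) = \<alpha> s"
        by (simp add: bcv_proj_def hopf_immersion_def vec_eq_iff forall_2)
      ultimately show ?thesis
        using subsetD[OF cyl, of "hopf_immersion \<alpha> (vector [s, 0])"] by (auto simp: hopf_cylinder_def)
    qed
    then show "proper_biharmonic_surface (hopf_domain I) (bcv_metric m l) (hopf_immersion \<alpha>)"
      by (intro proper_biharmonic_if_in_circle[OF I m pos C]) blast
  qed
qed

end
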